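(* There exists a function $f\in C(\lambda)$ that is a Besicovitch-Morse function, i.e. $f$ is both a Besicovitch function and a Morse function.
   Context: Let $I=[0,1]$, let $\lambda$ be the Lebesgue measure on $I$, and let $\mathcal B$ be the Borel sets of $I$. $C(\lambda)$ denotes the set of all continuous functions $f$ from $I$ onto $I$ that preserve $\lambda$, i.e. $\lambda(A)=\lambda(f^{-1}(A))$ for all $A\in\mathcal B$. The Dini derivatives of $f$ at $t\in I$ are $D^{+}f(t)=\limsup_{x\to t^{+},\,x\in I}\frac{f(x)-f(t)}{x-t}$, $D_{+}f(t)=\liminf_{x\to t^{+},\,x\in I}\frac{f(x)-f(t)}{x-t}$, $D^{-}f(t)=\limsup_{x\to t^{-},\,x\in I}\frac{f(x)-f(t)}{x-t}$, $D_{-}f(t)=\liminf_{x\to t^{-},\,x\in I}\frac{f(x)-f(t)}{x-t}$, with values in $\mathbb R\cup\{\pm\infty\}$. A finite or infinite right derivative exists at $t$ if $D^+f(t)=D_+f(t)\in\mathbb R\cup\{\pm\infty\}$; a finite or infinite left derivative exists at $t$ if $D^-f(t)=D_-f(t)\in\mathbb R\cup\{\pm\infty\}$. A Besicovitch function is a continuous function $f\colon I\to\mathbb R$ such that for every $t\in I$ there is neither a finite or infinite right derivative nor a finite or infinite left derivative at $t$ (at $t=0$ only the right derivative, and at $t=1$ only the left derivative, is considered). A Morse function is a continuous function $f\colon I\to\mathbb R$ such that for every $t\in I$ $$\max\{|D^+f(t)|,|D_+f(t)|\}=\max\{|D^-f(t)|,|D_-f(t)|\}=\infty,$$ where at $t=1$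 the term involving $D^+,D_+$ is omitted and at $t=0$ the term involving $D^-,D_-$ is omitted. *)

theory Defs
  imports "HOL-Analysis.Analysis"
begin

text \<open>
  Functions on the unit interval are represented by total functions of type \<open>real \<Rightarrow> real\<close>;
  their values outside \<open>unit_I\<close> play no role: Dini derivatives are only taken at points of
  \<open>unit_I\<close>, along points of \<open>unit_I\<close>.
\<close>

abbreviation unit_I :: "real set" where
  "unit_I \<equiv> {0..1}"

definition C_lambda :: "(real \<Rightarrow> real) set" where
  "C_lambda = {f. continuous_on unit_I f \<and> f ` unit_I = unit_I \<and>
     (\<forall>A \<in> sets borel. A \<subseteq> unit_I \<longrightarrow>
        emeasure lborel A = emeasure lborel (f -` A \<inter> unit_I))}"

definition diff_quot :: "(real \<Rightarrow> real) \<Rightarrow> real \<Rightarrow> real \<Rightarrow> ereal" where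
  "diff_quot f t x = ereal ((f x - f t) / (x - t))"

text \<open>
  The right-hand filter is trivial at \<open>t = 1\<close> and the left-hand one at \<open>t = 0\<close>, so the
  corresponding Dini derivatives are meaningful only for \<open>t \<in> {0..<1}\<close> and
  \<open>t \<in> {0<..1}\<close> respectively.
\<close>

definition dini_upper_right :: "(real \<Rightarrow> real) \<Rightarrow> real \<Rightarrow> ereal" where
  "dini_upper_right f t = Limsup (at t within (unit_I \<inter> {t<..})) (diff_quot f t)"

definition dini_lower_right :: "(real \<Rightarrow> real) \<Rightarrow> real \<Rightarrow> ereal" where
  "dini_lower_right f t = Liminf (at t within (unit_I \<inter> {t<..})) (diff_quot f t)"

definition dini_upper_left :: "(real \<Rightarrow> real) \<Rightarrow> real \<Rightarrow> ereal" where
  "dini_upper_left f t = Limsup (at t within (unit_I \<inter> {..<t})) (diff_quot f t)"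

definition dini_lower_left :: "(real \<Rightarrow> real) \<Rightarrow> real \<Rightarrow> ereal" where
  "dini_lower_left f t = Liminf (at t within (unit_I \<inter> {..<t})) (diff_quot f t)"

text \<open>As the Dini derivatives are extended reals, infinite one-sided derivatives are included.\<close>

definition right_derivative_exists :: "(real \<Rightarrow> real) \<Rightarrow> real \<Rightarrow> bool" where
  "right_derivative_exists f t \<longleftrightarrow> dini_upper_right f t = dini_lower_right f t"

definition left_derivative_exists :: "(real \<Rightarrow> real) \<Rightarrow> real \<Rightarrow> bool" where
  "left_derivative_exists f t \<longleftrightarrow> dini_upper_left f t = dini_lower_left f t"

definition besicovitch_function :: "(real \<Rightarrow> real) \<Rightarrow> bool" where
  "besicovitch_function f \<longleftrightarrow> continuous_on unit_I f \<and>
     (\<forall>t \<in> unit_I. (t \<noteq> 1 \<longrightarrow> \<not> right_derivative_exists f t) \<and>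
                  (t \<noteq> 0 \<longrightarrow> \<not> left_derivative_exists f t))"

definition morse_function :: "(real \<Rightarrow> real) \<Rightarrow> bool" where
  "morse_function f \<longleftrightarrow> continuous_on unit_I f \<and>
     (\<forall>t \<in> unit_I.
        (t \<noteq> 1 \<longrightarrow> max \<bar>dini_upper_right f t\<bar> \<bar>dini_lower_right f t\<bar> = \<infinity>) \<and>
        (t \<noteq> 0 \<longrightarrow> max \<bar>dini_upper_left f t\<bar> \<bar>dini_lower_left f t\<bar> = \<infinity>))"

end

theory Submission
  imports Defs "HOL-Library.Discrete_Functions"
begin

text \<open>
  The example comes from one continuous function \<open>T\<close> on \<open>[0, 1]\<close>, a variant of Besicovitch's
  stepped triangle: it rises from \<open>T 0 = 0\<close> to \<open>T (1 / 2) = 1\<close> and is symmetric about \<open>1 / 2\<close>.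
  On the left half it follows a staircase \<open>L\<close>, an increasing continuous function that is constant
  on countably many disjoint gaps. From the tread over each gap hangs a copy of \<open>T\<close> itself, turned
  upside down. The gap at level \<open>\<beta> i\<close> carries a copy of height \<open>h i\<close> and has length
  \<open>g i = \<rho> i * h i\<close> with \<open>\<rho> i \<le> 1 / 4\<close>, so a copy is at least four times as steep as its original.

  To the right of every point there must be arbitrarily close points where the difference quotient
  stays bounded (\<open>flat_right\<close>), and others where it is arbitrarily large in absolute value
  (\<open>steep_right\<close>); symmetry then settles the left side, and the two properties together exclude a
  finite or infinite one-sided derivative and force an infinite Dini derivative. There are two kinds
  of points.

  A point may lie in infinitely many nested copies. The slopes of these copies grow
  geometrically, which gives steepness. For flatness, the value at the point is even attained
  again further to the right in each copy: on the left half by symmetry, and on the right half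
  because a hanging copy stays below its tread, from which \<open>T\<close> still has to come down to \<open>0\<close>.

  Every other point corresponds, within some copy, to a point of the staircase outside the open
  gaps. The part of the staircase outside the gaps has positive length between any two levels, so
  that near a positive level the staircase itself provides bounded quotients; and the heights tend
  to \<open>0\<close> so slowly that every positive level is approached by gaps whose height is much larger than the
  distance of their level. At the base point \<open>0\<close> the roles are exchanged: the staircase is
  infinitely steep there, and copies that hang down exactly to \<open>0\<close> provide quotient \<open>0\<close>.

  The function \<open>T\<close> need not preserve Lebesgue measure, but its distribution function
  \<open>P y = \<lambda> {x. T x \<le> y}\<close> is bi-Lipschitz on \<open>[0, 1]\<close>. Hence \<open>f = P \<circ> T\<close> inherits both
  properties from \<open>T\<close>, and it preserves Lebesgue measure because a random variable composed
  with its continuous distribution function is uniformly distributed. The upper Lipschitz bound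
  holds because the gaps reproduce, by self-similarity, at most half of the density of \<open>T\<close>; the
  lower one because the staircase contributes a positive density above level \<open>1 / 4\<close>, which the
  copy hanging from level \<open>1 / 2\<close> reflects to the levels below.
\<close>

section \<open>Gap data\<close>

text \<open>
  The levels, heights and ratios of the gaps. The covering conditions can only hold for all \<open>N\<close>
  if \<open>\<Sum>i. h i\<close> diverges, since they place every level in \<open>{0<..<1}\<close> in infinitely many of the intervals of radius
  \<open>h i\<close> around \<open>\<beta> i\<close>; this is why only the ratios are summable. The bound \<open>h i \<le> \<beta> i\<close> keeps the
  copies above \<open>0\<close>, and \<open>touching_zero\<close> asks for copies near the base point that reach down to \<open>0\<close>.
\<close>

locale gap_data =
  fixes \<beta> h \<rho> :: "nat \<Rightarrow> real"
  assumes inj_level: "inj \<beta>"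
    and level_less: "\<beta> i < 1"
    and height_pos: "0 < h i"
    and height_le_level: "h i \<le> \<beta> i"
    and height_le_half: "h i \<le> 1 / 2"
    and height_tendsto: "h \<longlonglongrightarrow> 0"
    and ratio_pos: "0 < \<rho> i"
    and ratio_summable: "summable \<rho>"
    and ratio_suminf: "suminf \<rho> \<le> 1 / 4"
    and cover_right: "\<lbrakk>0 < y; y < 1; 0 < \<delta>\<rbrakk> \<Longrightarrow> \<exists>i. y < \<beta> i \<and> \<beta> i < y + \<delta> \<and> N * (\<beta> i - y) \<le> h i"
    and cover_left: "\<lbrakk>0 < y; y \<le> 1; 0 < \<delta>\<rbrakk> \<Longrightarrow> \<exists>i. y - \<delta> < \<beta> i \<and> \<beta> i < y \<and> N * (y - \<beta> i) \<le> h i"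
    and touching_zero: "0 < \<delta> \<Longrightarrow> \<exists>i. \<beta> i < \<delta> \<and> h i = \<beta> i"
    and half_gap: "\<beta> 0 = 1 / 2" "h 0 = 1 / 2"
begin

definition g :: "nat \<Rightarrow> real" where "g i = \<rho> i * h i"

definition weight :: "(nat \<Rightarrow> real) \<Rightarrow> real set \<Rightarrow> real" where
  "weight c A = (\<Sum>i. c i * indicator A (\<beta> i))"

text \<open>
  With this coefficient the staircase, made up of the gaps and of the rest, has length \<open>1 / 2\<close>.
\<close>

definition \<kappa> :: real where "\<kappa> = 1 / 2 - suminf g"

text \<open>
  The staircase is described by its inverse: \<open>lo y\<close> and \<open>hi y\<close> are the first and the last abscissa
  at level \<open>y\<close>, and they differ exactly at the levels of gaps. The part outside the gaps contributes
  \<open>\<kappa> * y\<^sup>2\<close>. Its derivative is positive for \<open>y > 0\<close>, which bounds the slope of the staircase at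
  positive levels, and vanishes at \<open>0\<close>, which makes the staircase steep at its foot.
\<close>

definition lo :: "real \<Rightarrow> real" where "lo y = \<kappa> * y\<^sup>2 + weight g {..<y}"

definition hi :: "real \<Rightarrow> real" where "hi y = \<kappa> * y\<^sup>2 + weight g {..y}"

abbreviation gap :: "nat \<Rightarrow> real set" where "gap i \<equiv> {lo (\<beta> i)<..<hi (\<beta> i)}"

lemma level_pos: "0 < \<beta> i"
  using height_pos[of i] height_le_level[of i] by linarith

lemma g_pos: "0 < g i"
  by (simp add: g_def height_pos ratio_pos)

lemma ratio_le: "\<rho> i \<le> 1 / 4"
proof -
  have "sum \<rho> {i} \<le> suminf \<rho>"
    by (rule sum_le_suminf[OF ratio_summable]) (auto intro: less_imp_le ratio_pos)
  then show ?thesis using ratio_suminf by simp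
qed

lemma g_le: "g i \<le> \<rho> i" and g_le_height: "g i \<le> h i / 4"
proof -
  show "g i \<le> \<rho> i"
    unfolding g_def using height_le_half[of i] ratio_pos[of i] by (simp add: mult_left_le)
  show "g i \<le> h i / 4"
    unfolding g_def using mult_right_mono[OF ratio_le, of "h i" i] height_pos[of i] by simp
qed

lemma g_summable: "summable g"
  by (rule summable_comparison_test'[OF ratio_summable, of 0]) (use g_le g_pos in \<open>auto simp: less_imp_le abs_of_pos\<close>)

lemma kappa_bounds: "1 / 4 \<le> \<kappa>" "\<kappa> \<le> 1 / 2"
proof -
  have "suminf g \<le> suminf \<rho>" by (intro suminf_le g_le g_summable ratio_summable)
  then show "1 / 4 \<le> \<kappa>" using ratio_suminf by (simp add: \<kappa>_def)
  have "0 \<le> suminf g" by (intro suminf_nonneg g_summable less_imp_le g_pos)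
  then show "\<kappa> \<le> 1 / 2" by (simp add: \<kappa>_def)
qed

lemma weight_summable:
  fixes c :: "nat \<Rightarrow> real"
  assumes "summable c" "\<And>i. 0 \<le> c i"
  shows "summable (\<lambda>i. c i * indicator A (\<beta> i))"
  by (rule summable_comparison_test'[where N = 0, OF assms(1)]) (use assms(2) in \<open>auto simp: indicator_def\<close>)

lemmas weight_summable_g = weight_summable[OF g_summable less_imp_le[OF g_pos]]
lemmas weight_summable_ratio = weight_summable[OF ratio_summable less_imp_le[OF ratio_pos]]

lemma weight_nonneg: "0 \<le> weight g A"
  unfolding weight_def
  by (intro suminf_nonneg weight_summable_g) (auto simp: less_imp_le g_pos)

lemma weight_mono: "A \<subseteq> B \<Longrightarrow> weight g A \<le> weight g B"
  unfolding weight_def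
  by (intro suminf_le weight_summable_g) (auto simp: indicator_def less_imp_le g_pos)

lemma weight_Un: "A \<inter> B = {} \<Longrightarrow> weight g (A \<union> B) = weight g A + weight g B"
  unfolding weight_def
  by (subst suminf_add[OF weight_summable_g weight_summable_g])
     (intro suminf_cong, auto simp: indicator_def)

lemma weight_single: "weight g {\<beta> i} = g i"
proof -
  have "(\<lambda>j. g j * indicator {\<beta> i} (\<beta> j)) = (\<lambda>j. if j = i then g j else 0)"
    using inj_level by (auto simp: fun_eq_iff inj_eq)
  then show ?thesis unfolding weight_def using sums_single[of i g] by (simp add: sums_iff)
qed

lemma weight_eq_0: "(\<And>i. \<beta> i \<notin> A) \<Longrightarrow> weight g A = 0"
  unfolding weight_def by simp

text \<open>
  If all gaps with levels in \<open>A\<close> have height at most \<open>c\<close>, their total length is at most \<open>c\<close> times a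
  total ratio; the latter tends to \<open>0\<close> near any level (\<open>weight_ratio_small\<close>). Thus gaps next to a
  tall gap are short compared with its height.
\<close>

lemma weight_le_height:
  assumes "\<And>i. \<beta> i \<in> A \<Longrightarrow> h i \<le> c" "0 \<le> c"
  shows "weight g A \<le> c * weight \<rho> A"
proof -
  have "g i * indicator A (\<beta> i) \<le> c * (\<rho> i * indicator A (\<beta> i))" for i
    using assms(1)[of i] ratio_pos[of i] by (auto simp: indicator_def g_def)
  then have "weight g A \<le> (\<Sum>i. c * (\<rho> i * indicator A (\<beta> i)))"
    unfolding weight_def
    by (intro suminf_le weight_summable_g summable_mult weight_summable_ratio)
  then show ?thesis unfolding weight_def by (simp add: suminf_mult weight_summable_ratio)
qed

lemma weight_ratio_mono: "A \<subseteq> B \<Longrightarrow> weight \<rho> A \<le> weight \<rho> B"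
  unfolding weight_def
  by (intro suminf_le weight_summable_ratio) (auto simp: indicator_def less_imp_le ratio_pos)

lemma weight_g_le_ratio: "weight g A \<le> weight \<rho> A"
  unfolding weight_def
  by (intro suminf_le weight_summable_ratio weight_summable_g) (auto simp: indicator_def g_le)

lemma weight_ratio_small:
  assumes "0 < \<epsilon>"
  shows "\<exists>\<delta>>0. weight \<rho> {x. x \<noteq> y \<and> \<bar>x - y\<bar> < \<delta>} \<le> \<epsilon>"
proof -
  obtain J where J: "\<bar>\<Sum>i. \<rho> (i + J)\<bar> < \<epsilon>"
    using suminf_exist_split[OF assms ratio_summable] by auto
  define D where "D = insert 1 ((\<lambda>i. \<bar>\<beta> i - y\<bar>) ` {i. i < J \<and> \<beta> i \<noteq> y})"
  have D: "finite D" "D \<noteq> {}" "\<And>d. d \<in> D \<Longrightarrow> 0 < d"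
    by (auto simp: D_def)
  define \<delta> where "\<delta> = Min D"
  have pos: "0 < \<delta>" using D by (simp add: \<delta>_def)
  let ?A = "{x. x \<noteq> y \<and> \<bar>x - y\<bar> < \<delta>}"
  have out: "\<beta> i \<notin> ?A" if "i < J" for i
  proof (cases "\<beta> i = y")
    case False
    then have "\<bar>\<beta> i - y\<bar> \<in> D" using that by (auto simp: D_def)
    then have "\<delta> \<le> \<bar>\<beta> i - y\<bar>" unfolding \<delta>_def using D(1) by (rule Min_le[rotated])
    then show ?thesis by auto
  qed simp
  let ?f = "\<lambda>i. \<rho> i * indicator ?A (\<beta> i)"
  have "weight \<rho> ?A = (\<Sum>i. ?f (i + J)) + sum ?f {..<J}"
    unfolding weight_def by (rule suminf_split_initial_segment[OF weight_summable_ratio])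
  also have "sum ?f {..<J} = 0" using out by (intro sum.neutral) (auto simp: indicator_def)
  also have "(\<Sum>i. ?f (i + J)) \<le> (\<Sum>i. \<rho> (i + J))"
    by (intro suminf_le)
       (use weight_summable_ratio ratio_summable in
         \<open>auto simp: less_imp_le ratio_pos summable_iff_shift[of \<rho>]
            summable_iff_shift[of "\<lambda>i. \<rho> i * indicator _ (\<beta> i)"] split: split_indicator\<close>)
  finally show ?thesis using J pos by (intro exI[of _ \<delta>]) auto
qed

section \<open>The staircase\<close>

lemma lo_le_hi: "lo y \<le> hi y"
  unfolding lo_def hi_def by (simp add: weight_mono lessThan_subset_iff subset_iff)

lemma hi_level: "hi (\<beta> i) = lo (\<beta> i) + g i"
proof -
  have "{..\<beta> i} = {..<\<beta> i} \<union> {\<beta> i}" by auto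
  then show ?thesis by (simp add: lo_def hi_def weight_Un weight_single del: Un_insert_right)
qed

lemma lo_less_hi_level: "lo (\<beta> i) < hi (\<beta> i)"
  using hi_level g_pos[of i] by simp

lemma hi_eq_lo: "y \<notin> range \<beta> \<Longrightarrow> hi y = lo y"
proof -
  assume "y \<notin> range \<beta>"
  moreover have "{..y} = {..<y} \<union> {y}" by auto
  ultimately have "weight g {..y} = weight g {..<y}"
    using weight_Un[of "{..<y}" "{y}"] weight_eq_0[of "{y}"] by auto
  then show ?thesis by (simp add: lo_def hi_def)
qed

lemma lo_minus_hi:
  assumes "y < y'"
  shows "lo y' - hi y = \<kappa> * (y'\<^sup>2 - y\<^sup>2) + weight g {y<..<y'}"
proof -
  have "{..<y'} = {..y} \<union> {y<..<y'}" using assms by auto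
  then have "weight g {..<y'} = weight g {..y} + weight g {y<..<y'}"
    using weight_Un[of "{..y}" "{y<..<y'}"] by fastforce
  then show ?thesis by (simp add: lo_def hi_def algebra_simps)
qed

lemma hi_minus_lo:
  assumes "y \<le> y'"
  shows "hi y' - lo y = \<kappa> * (y'\<^sup>2 - y\<^sup>2) + weight g {y..y'}"
proof -
  have "{..y'} = {..<y} \<union> {y..y'}" using assms by auto
  then have "weight g {..y'} = weight g {..<y} + weight g {y..y'}"
    using weight_Un[of "{..<y}" "{y..y'}"] by fastforce
  then show ?thesis by (simp add: lo_def hi_def algebra_simps)
qed

lemma hi_minus_hi:
  assumes "y \<le> y'"
  shows "hi y' - hi y = \<kappa> * (y'\<^sup>2 - y\<^sup>2) + weight g {y<..y'}"
proof -
  have "{..y'} = {..y} \<union> {y<..y'}" using assms by auto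
  then have "weight g {..y'} = weight g {..y} + weight g {y<..y'}"
    using weight_Un[of "{..y}" "{y<..y'}"] by fastforce
  then show ?thesis by (simp add: hi_def algebra_simps)
qed

lemma lo_minus_lo:
  assumes "y \<le> y'"
  shows "lo y' - lo y = \<kappa> * (y'\<^sup>2 - y\<^sup>2) + weight g {y..<y'}"
proof -
  have "{..<y'} = {..<y} \<union> {y..<y'}" using assms by auto
  then have "weight g {..<y'} = weight g {..<y} + weight g {y..<y'}"
    using weight_Un[of "{..<y}" "{y..<y'}"] by fastforce
  then show ?thesis by (simp add: lo_def algebra_simps)
qed

lemma kappa_squares_le:
  assumes "0 \<le> y" "y \<le> y'" "y' \<le> 1"
  shows "\<kappa> * (y'\<^sup>2 - y\<^sup>2) \<le> y' - y"
proof -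
  have "\<kappa> * (y'\<^sup>2 - y\<^sup>2) = (\<kappa> * (y' + y)) * (y' - y)" by (simp add: power2_eq_square algebra_simps)
  also have "\<dots> \<le> 1 * (y' - y)"
    using mult_mono[OF kappa_bounds(2), of "y' + y" 2] assms by (intro mult_right_mono) auto
  finally show ?thesis by simp
qed

lemma kappa_squares_ge:
  assumes "0 \<le> y" "y \<le> y'"
  shows "y' / 4 * (y' - y) \<le> \<kappa> * (y'\<^sup>2 - y\<^sup>2)"
proof -
  have "y' / 4 * (y' - y) \<le> \<kappa> * (y' + y) * (y' - y)"
    using mult_mono[OF kappa_bounds(1), of y' "y' + y"] kappa_bounds(1) assms by (intro mult_right_mono) auto
  also have "\<dots> = \<kappa> * (y'\<^sup>2 - y\<^sup>2)" by (simp add: power2_eq_square algebra_simps)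
  finally show ?thesis .
qed

lemma hi_lo_quadratic:
  assumes "y < y'"
  shows "\<kappa> * (y'\<^sup>2 - y\<^sup>2) \<le> lo y' - hi y"
  using lo_minus_hi[OF assms] weight_nonneg by simp

lemma hi_less_lo:
  assumes "0 \<le> y" "y < y'"
  shows "hi y < lo y'"
proof -
  have "y\<^sup>2 < y'\<^sup>2" using assms by (simp add: power_strict_mono)
  then have "0 < \<kappa> * (y'\<^sup>2 - y\<^sup>2)" using kappa_bounds by simp
  then show ?thesis using hi_lo_quadratic[OF assms(2)] by linarith
qed

lemma lo_0: "lo 0 = 0" and hi_0: "hi 0 = 0"
proof -
  have "weight g {..0} = 0" "weight g {..<0} = 0"
    by (rule weight_eq_0, use level_pos in \<open>auto simp: not_le less_imp_le not_less\<close>)+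
  then show "lo 0 = 0" "hi 0 = 0" by (auto simp: lo_def hi_def)
qed

lemma lo_1: "lo 1 = 1 / 2" and hi_1: "hi 1 = 1 / 2"
proof -
  have "weight g {..1} = suminf g" "weight g {..<1} = suminf g"
    unfolding weight_def using level_less by (auto simp: indicator_def less_imp_le)
  then show "lo 1 = 1 / 2" "hi 1 = 1 / 2" by (auto simp: lo_def hi_def \<kappa>_def)
qed

lemma lo_mono: "0 \<le> y \<Longrightarrow> y \<le> y' \<Longrightarrow> lo y \<le> lo y'"
  using hi_less_lo[of y y'] lo_le_hi[of y] by (cases "y = y'") auto

lemma hi_mono: "0 \<le> y \<Longrightarrow> y \<le> y' \<Longrightarrow> hi y \<le> hi y'"
  using hi_less_lo[of y y'] lo_le_hi[of y'] by (cases "y = y'") auto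

lemma lo_nonneg: "0 \<le> y \<Longrightarrow> 0 \<le> lo y"
  using lo_mono[of 0 y] lo_0 by simp

lemma lo_pos: "0 < y \<Longrightarrow> 0 < lo y"
  using hi_less_lo[of 0 y] hi_0 by simp

lemma hi_le_half: "0 \<le> y \<Longrightarrow> y \<le> 1 \<Longrightarrow> hi y \<le> 1 / 2"
  using hi_mono[of y 1] hi_1 by simp

lemma hi_less_half: "0 \<le> y \<Longrightarrow> y < 1 \<Longrightarrow> hi y < 1 / 2"
  using hi_less_lo[of y 1] lo_1 by simp

lemma hi_le: assumes "0 \<le> y" "y \<le> 1" shows "hi y \<le> y"
proof -
  have "weight g {..y} \<le> y * weight \<rho> {..y}"
    by (rule weight_le_height) (use assms height_le_level order_trans in \<open>auto\<close>)
  also have "weight \<rho> {..y} \<le> suminf \<rho>"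
    unfolding weight_def
    by (intro suminf_le weight_summable_ratio ratio_summable) (auto simp: indicator_def less_imp_le ratio_pos)
  then have "weight \<rho> {..y} \<le> 1 / 4" using ratio_suminf by linarith
  then have "y * weight \<rho> {..y} \<le> y * (1 / 4)" using assms by (intro mult_left_mono) auto
  finally have "weight g {..y} \<le> y / 4" by simp
  moreover have "\<kappa> * y\<^sup>2 \<le> 1 / 2 * y"
    using assms kappa_bounds by (intro mult_mono) (auto simp: power2_eq_square mult_left_le)
  ultimately show ?thesis using assms by (simp add: hi_def)
qed

text \<open>
  One-sided continuity of \<open>lo\<close> and \<open>hi\<close>. The two cases, \<open>y1 = y\<close> and \<open>y2 = y\<close>, are treated
  together: only the levels strictly between \<open>y1\<close> and \<open>y2\<close> matter, and \<open>y\<close> is not among them.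
\<close>

lemma lo_hi_close:
  assumes "0 < \<epsilon>" "0 \<le> y" "y \<le> 1"
  shows "\<exists>\<delta>>0. \<forall>y1 y2. 0 \<le> y1 \<longrightarrow> y1 < y2 \<longrightarrow> y2 \<le> 1 \<longrightarrow> y \<notin> {y1<..<y2} \<longrightarrow>
     \<bar>y1 - y\<bar> < \<delta> \<longrightarrow> \<bar>y2 - y\<bar> < \<delta> \<longrightarrow> lo y2 - hi y1 < \<epsilon>"
proof -
  obtain \<delta>0 where d0: "\<delta>0 > 0" "weight \<rho> {x. x \<noteq> y \<and> \<bar>x - y\<bar> < \<delta>0} \<le> \<epsilon> / 2"
    using weight_ratio_small[of "\<epsilon> / 2" y] assms by auto
  show ?thesis
  proof (intro exI[of _ "min \<delta>0 (\<epsilon> / 4)"] conjI allI impI)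
    show "0 < min \<delta>0 (\<epsilon> / 4)" using d0 assms by auto
    fix y1 y2 :: real
    assume y: "0 \<le> y1" "y1 < y2" "y2 \<le> 1" "y \<notin> {y1<..<y2}" 
      "\<bar>y1 - y\<bar> < min \<delta>0 (\<epsilon> / 4)" "\<bar>y2 - y\<bar> < min \<delta>0 (\<epsilon> / 4)"
    have "weight g {y1<..<y2} \<le> weight \<rho> {y1<..<y2}" by (rule weight_g_le_ratio)
    also have "\<dots> \<le> weight \<rho> {x. x \<noteq> y \<and> \<bar>x - y\<bar> < \<delta>0}"
      by (rule weight_ratio_mono) (use y in auto)
    also have "\<dots> \<le> \<epsilon> / 2" by (rule d0)
    finally have w: "weight g {y1<..<y2} \<le> \<epsilon> / 2" .
    have "\<kappa> * (y2\<^sup>2 - y1\<^sup>2) \<le> y2 - y1" by (rule kappa_squares_le) (use y in auto)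
    also have "\<dots> < \<epsilon> / 2"
    proof -
      have "\<bar>y1 - y\<bar> < \<epsilon> / 4" "\<bar>y2 - y\<bar> < \<epsilon> / 4" using y(5,6) by auto
      then have "y - y1 < \<epsilon> / 4" "y2 - y < \<epsilon> / 4" by linarith+
      then show ?thesis by simp
    qed
    finally show "lo y2 - hi y1 < \<epsilon>" using w lo_minus_hi[OF y(2)] by linarith
  qed
qed

definition L :: "real \<Rightarrow> real" where
  "L u = (THE y. 0 \<le> y \<and> y \<le> 1 \<and> lo y \<le> u \<and> u \<le> hi y)"

text \<open>
  The supremum of the levels reached by \<open>u\<close> works, because \<open>lo\<close> is left-continuous and \<open>hi\<close> is
  right-continuous.
\<close>

lemma level_exists:
  assumes "0 \<le> u" "u \<le> 1 / 2"
  shows "\<exists>y. 0 \<le> y \<and> y \<le> 1 \<and> lo y \<le> u \<and> u \<le> hi y"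
proof -
  define S where "S = {y. 0 \<le> y \<and> y \<le> 1 \<and> lo y \<le> u}"
  have S0: "0 \<in> S" using assms lo_0 by (simp add: S_def)
  have bdd: "bdd_above S" by (auto simp: S_def bdd_above_def)
  define y where "y = Sup S"
  have y: "0 \<le> y" "y \<le> 1"
    unfolding y_def using S0 bdd by (auto intro!: cSup_upper cSup_least simp: S_def)
  have below: "hi z \<le> u" if "0 \<le> z" "z < y" for z
  proof -
    have "z < Sup S" using that y_def by simp
    then obtain x where "x \<in> S" "z < x" using less_cSupE[of z S] S0 by blast
    then show ?thesis using hi_less_lo[of z x] that by (auto simp: S_def)
  qed
  have above: "u < lo z" if "y < z" "z \<le> 1" for z
    using that y cSup_upper[OF _ bdd, of z] unfolding y_def[symmetric] by (force simp: S_def)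
  have "lo y \<le> u"
  proof (cases "y = 0")
    case True then show ?thesis using assms lo_0 by simp
  next
    case False
    show ?thesis
    proof (rule field_le_epsilon)
      fix e :: real assume "0 < e"
      then obtain \<delta> where d: "\<delta> > 0" "\<And>y1 y2. 0 \<le> y1 \<Longrightarrow> y1 < y2 \<Longrightarrow> y2 \<le> 1 \<Longrightarrow> y \<notin> {y1<..<y2} \<Longrightarrow>
         \<bar>y1 - y\<bar> < \<delta> \<Longrightarrow> \<bar>y2 - y\<bar> < \<delta> \<Longrightarrow> lo y2 - hi y1 < e"
        using lo_hi_close[of e y] y by blast
      define z where "z = max 0 (y - \<delta> / 2)"
      have "lo y - hi z < e" using d(1) y False by (intro d(2)) (auto simp: z_def)
      moreover have "hi z \<le> u" using d(1) y False by (intro below) (auto simp: z_def)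
      ultimately show "lo y \<le> u + e" by simp
    qed
  qed
  moreover have "u \<le> hi y"
  proof (cases "y = 1")
    case True then show ?thesis using assms hi_1 by simp
  next
    case False
    show ?thesis
    proof (rule field_le_epsilon)
      fix e :: real assume "0 < e"
      then obtain \<delta> where d: "\<delta> > 0" "\<And>y1 y2. 0 \<le> y1 \<Longrightarrow> y1 < y2 \<Longrightarrow> y2 \<le> 1 \<Longrightarrow> y \<notin> {y1<..<y2} \<Longrightarrow>
         \<bar>y1 - y\<bar> < \<delta> \<Longrightarrow> \<bar>y2 - y\<bar> < \<delta> \<Longrightarrow> lo y2 - hi y1 < e"
        using lo_hi_close[of e y] y by blast
      define z where "z = min 1 (y + \<delta> / 2)"
      have "lo z - hi y < e" using d(1) y False by (intro d(2)) (auto simp: z_def)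
      moreover have "u < lo z" using d(1) y False by (intro above) (auto simp: z_def)
      ultimately show "u \<le> hi y + e" by simp
    qed
  qed
  ultimately show ?thesis using y by auto
qed

lemma L_eqI:
  assumes "0 \<le> y" "y \<le> 1" "lo y \<le> u" "u \<le> hi y"
  shows "L u = y"
  unfolding L_def
proof (rule the_equality)
  fix z assume z: "0 \<le> z \<and> z \<le> 1 \<and> lo z \<le> u \<and> u \<le> hi z"
  then show "z = y" using assms hi_less_lo[of y z] hi_less_lo[of z y] by (cases y z rule: linorder_cases) auto
qed (use assms in auto)

lemma L_props:
  assumes "0 \<le> u" "u \<le> 1 / 2"
  shows "0 \<le> L u" "L u \<le> 1" "lo (L u) \<le> u" "u \<le> hi (L u)"
  using level_exists[OF assms] L_eqI by auto

text \<open>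
  The staircase is Hoelder continuous with exponent \<open>1 / 2\<close>: climbing from \<open>L u\<close> to \<open>L v\<close> takes at
  least the length \<open>\<kappa> * ((L v)\<^sup>2 - (L u)\<^sup>2)\<close> outside the gaps.
\<close>

lemma L_holder:
  assumes "0 \<le> u" "u \<le> v" "v \<le> 1 / 2"
  shows "L u \<le> L v \<and> (L v - L u)\<^sup>2 \<le> 4 * (v - u)"
proof -
  have u: "0 \<le> L u" "L u \<le> 1" "lo (L u) \<le> u" "u \<le> hi (L u)"
   and v: "0 \<le> L v" "L v \<le> 1" "lo (L v) \<le> v" "v \<le> hi (L v)"
    using L_props[of u] L_props[of v] assms by auto
  have le: "L u \<le> L v" using hi_less_lo[of "L v" "L u"] u v assms by (cases "L u \<le> L v") auto
  show ?thesis
  proof (cases "L u = L v")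
    case False
    then have lt: "L u < L v" using le by simp
    have "(L v - L u)\<^sup>2 \<le> (L v)\<^sup>2 - (L u)\<^sup>2"
    proof -
      have "(L v)\<^sup>2 - (L u)\<^sup>2 - (L v - L u)\<^sup>2 = 2 * L u * (L v - L u)"
        by (simp add: power2_eq_square algebra_simps)
      moreover have "0 \<le> 2 * L u * (L v - L u)" using u le by simp
      ultimately show ?thesis by linarith
    qed
    also have "\<dots> \<le> 4 * \<kappa> * ((L v)\<^sup>2 - (L u)\<^sup>2)"
    proof -
      have "0 \<le> (4 * \<kappa> - 1) * ((L v)\<^sup>2 - (L u)\<^sup>2)"
        using kappa_bounds le u by (intro mult_nonneg_nonneg) (auto intro: power_mono)
      then show ?thesis by (simp add: algebra_simps)
    qed
    also have "\<dots> \<le> 4 * (v - u)" using hi_lo_quadratic[OF lt] u v by simp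
    finally show ?thesis using le by simp
  qed (use assms in auto)
qed

section \<open>The self-similar function\<close>

text \<open>
  All functions are evaluated after folding the line onto \<open>[0, 1 / 2]\<close>, which builds in the
  symmetry about \<open>1 / 2\<close> and the value \<open>0\<close> outside the unit interval.
\<close>

definition tent :: "real \<Rightarrow> real" where "tent x = max 0 (min x (1 - x))"

definition pos :: "nat \<Rightarrow> real \<Rightarrow> real" where "pos i u = (u - lo (\<beta> i)) / g i"

text \<open>
  The self-similarity operator: it hangs a copy of \<open>F\<close> from every tread of the staircase. Its fixed
  point is \<open>T\<close>.
\<close>

definition step :: "(real \<Rightarrow> real) \<Rightarrow> real \<Rightarrow> real" where
  "step F x = (if \<exists>i. tent x \<in> gap i
     then let i = (THE i. tent x \<in> gap i) in \<beta> i - h i * F (pos i (tent x))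
     else L (tent x))"

lemma tent_bounds: "0 \<le> tent x" "tent x \<le> 1 / 2"
  by (auto simp: tent_def max_def min_def)

lemma tent_reflect: "tent (1 - x) = tent x"
  by (auto simp: tent_def min_def)

lemma tent_id: "0 \<le> u \<Longrightarrow> u \<le> 1 / 2 \<Longrightarrow> tent u = u"
  by (auto simp: tent_def)

lemma tent_eq_0: "x \<le> 0 \<or> 1 \<le> x \<Longrightarrow> tent x = 0"
  by (auto simp: tent_def)

lemma gap_subset: "u \<in> gap i \<Longrightarrow> 0 < u \<and> u < 1 / 2"
  using lo_pos[OF level_pos, of i] hi_less_half[of "\<beta> i"] level_pos[of i] level_less[of i] by auto

lemma L_gap: "lo (\<beta> i) \<le> u \<Longrightarrow> u \<le> hi (\<beta> i) \<Longrightarrow> L u = \<beta> i"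
  using level_pos[of i] level_less[of i] by (intro L_eqI) auto

lemma gap_unique: "u \<in> gap i \<Longrightarrow> u \<in> gap j \<Longrightarrow> i = j"
  using L_gap[of i u] L_gap[of j u] inj_level by (auto simp: inj_eq)

lemma the_gap: "u \<in> gap i \<Longrightarrow> (THE j. u \<in> gap j) = i"
  using gap_unique by blast

lemma pos_gap_iff: "pos i u \<in> {0<..<1} \<longleftrightarrow> u \<in> gap i"
  using g_pos[of i] hi_level[of i] by (auto simp: pos_def field_simps)

lemma step_gap: "tent x \<in> gap i \<Longrightarrow> step F x = \<beta> i - h i * F (pos i (tent x))"
  using the_gap by (auto simp: step_def)

lemma step_regular: "(\<And>i. tent x \<notin> gap i) \<Longrightarrow> step F x = L (tent x)"
  by (auto simp: step_def)

definition admissible :: "(real \<Rightarrow> real) \<Rightarrow> bool" where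
  "admissible F \<longleftrightarrow> (\<forall>x. 0 \<le> F x \<and> F x \<le> 1) \<and> (\<forall>x. x \<notin> {0<..<1} \<longrightarrow> F x = 0)"

lemma L_0: "L 0 = 0"
  by (rule L_eqI) (auto simp: lo_0 hi_0)

lemma step_admissible: 
  assumes "admissible F"
  shows "admissible (step F)"
  unfolding admissible_def
proof (intro conjI allI impI)
  fix x
  have "0 \<le> step F x \<and> step F x \<le> 1"
  proof (cases "\<exists>i. tent x \<in> gap i")
    case True
    then obtain i where i: "tent x \<in> gap i" by auto
    have F: "0 \<le> F (pos i (tent x))" "F (pos i (tent x)) \<le> 1" using assms by (auto simp: admissible_def)
    have "0 \<le> h i * F (pos i (tent x))" "h i * F (pos i (tent x)) \<le> h i"
      using F height_pos[of i] by (auto simp: mult_left_le)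
    then show ?thesis
      using step_gap[OF i, of F] level_less[of i] height_le_level[of i] by auto
  next
    case False
    then show ?thesis using step_regular[of x F] L_props[OF tent_bounds, of x] by auto
  qed
  then show "0 \<le> step F x" "step F x \<le> 1" by auto
  assume "x \<notin> {0<..<1}"
  then have f: "tent x = 0" by (intro tent_eq_0) auto
  then have "\<And>i. tent x \<notin> gap i" using gap_subset by fastforce
  then show "step F x = 0" using step_regular[of x F] f L_0 by simp
qed

lemma step_contraction:
  assumes "\<And>x. \<bar>F x - G x\<bar> \<le> d"
  shows "\<bar>step F x - step G x\<bar> \<le> 1 / 2 * d"
proof (cases "\<exists>i. tent x \<in> gap i")
  case True
  then obtain i where i: "tent x \<in> gap i" by auto
  have "\<bar>step F x - step G x\<bar> = h i * \<bar>F (pos i (tent x)) - G (pos i (tent x))\<bar>"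
  proof -
    have "step F x - step G x = h i * (G (pos i (tent x)) - F (pos i (tent x)))"
      by (simp add: step_gap[OF i] right_diff_distrib)
    then show ?thesis using height_pos[of i] by (simp add: abs_mult abs_minus_commute)
  qed
  also have "\<dots> \<le> 1 / 2 * d"
    using height_le_half[of i] height_pos[of i] assms[of "pos i (tent x)"] by (intro mult_mono) auto
  finally show ?thesis .
next
  case False
  moreover have "0 \<le> d" using assms[of 0] by linarith
  ultimately show ?thesis using step_regular[of x] by auto
qed

lemma continuous_L_tent: "continuous_on UNIV (\<lambda>x. L (tent x))"
proof -
  have "continuous_on {0..1/2} L"
    unfolding continuous_on_iff
  proof (intro ballI allI impI)
    fix u e :: real assume u: "u \<in> {0..1 / 2}" and e: "0 < e"
    show "\<exists>d>0. \<forall>v\<in>{0..1 / 2}. dist v u < d \<longrightarrow> dist (L v) (L u) < e"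
    proof (intro exI[of _ "e\<^sup>2 / 4"] conjI ballI impI)
      fix v assume v: "v \<in> {0..1/2}" "dist v u < e\<^sup>2 / 4"
      have "(L v - L u)\<^sup>2 \<le> 4 * \<bar>v - u\<bar>"
        using L_holder[of u v] L_holder[of v u] u v 
        by (cases "u \<le> v") (auto simp: power2_commute[of "L v"])
      also have "\<dots> < e\<^sup>2" using v by (simp add: dist_real_def)
      finally have "\<bar>L v - L u\<bar> < e" using power2_less_imp_less[of "\<bar>L v - L u\<bar>" e] e by simp
      then show "dist (L v) (L u) < e" by (simp add: dist_real_def)
    qed (use e in auto)
  qed
  moreover have "continuous_on UNIV tent" unfolding tent_def by (intro continuous_intros)
  ultimately show ?thesis
    by (rule continuous_on_compose2) (use tent_bounds in auto)
qed

text \<open>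
  Filling only the first \<open>n\<close> gaps gives a continuous function, and filling the others changes it by
  at most the supremum of their heights, which tends to \<open>0\<close>.
\<close>

lemma step_continuous:
  assumes F: "admissible F" "continuous_on UNIV F"
  shows "continuous_on UNIV (step F)"
proof (rule uniform_limit_theorem)
  let ?A = "\<lambda>n x. L (tent x) - (\<Sum>i<n. h i * F (pos i (tent x)))"
  have tent: "continuous_on UNIV tent" unfolding tent_def by (intro continuous_intros)
  have "continuous_on UNIV (\<lambda>x. F (pos i (tent x)))" for i
    by (rule continuous_on_compose2[OF F(2)]) (use g_pos[of i] in \<open>auto simp: pos_def intro!: continuous_intros tent\<close>)
  then show "\<forall>\<^sub>F n in sequentially. continuous_on UNIV (?A n)"
    by (intro always_eventually allI continuous_intros continuous_L_tent)
  show "uniform_limit UNIV ?A (step F) sequentially"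
    unfolding uniform_limit_iff
  proof (intro allI impI)
    fix e :: real assume "0 < e"
    then have "\<forall>\<^sub>F n in sequentially. dist (h n) 0 < e" using height_tendsto by (rule tendstoD[rotated])
    then obtain N where N: "\<And>n. n \<ge> N \<Longrightarrow> h n < e"
      using height_pos by (auto simp: eventually_sequentially dist_real_def abs_of_pos)
    have "dist (?A n x) (step F x) < e" if n: "n \<ge> N" for n x
    proof (cases "\<exists>i. tent x \<in> gap i")
      case True
      then obtain j where j: "tent x \<in> gap j" by auto
      have z: "F (pos i (tent x)) = 0" if "i \<noteq> j" for i
        using gap_unique[OF j, of i] that pos_gap_iff[of i "tent x"] F(1) by (auto simp: admissible_def)
      have "(\<Sum>i<n. h i * F (pos i (tent x))) = (\<Sum>i<n. if i = j then h j * F (pos j (tent x)) else 0)"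
        by (intro sum.cong) (auto simp: z)
      also have "\<dots> = (if j < n then h j * F (pos j (tent x)) else 0)" by simp
      finally have s: "(\<Sum>i<n. h i * F (pos i (tent x))) = (if j < n then h j * F (pos j (tent x)) else 0)" .
      have "L (tent x) = \<beta> j" using j L_gap by auto
      moreover have "h j * F (pos j (tent x)) \<le> h j" "0 \<le> h j * F (pos j (tent x))" 
        using F(1) height_pos[of j] by (auto simp: admissible_def mult_left_le)
      ultimately show ?thesis
        using s step_gap[OF j, of F] N[of j] n \<open>0 < e\<close> by (auto simp: dist_real_def)
    next
      case False
      then have "F (pos i (tent x)) = 0" for i
        using pos_gap_iff[of i "tent x"] F(1) by (auto simp: admissible_def)
      then show ?thesis using step_regular[of x F] False \<open>0 < e\<close> by auto
    qed
    then show "\<forall>\<^sub>F n in sequentially. \<forall>x\<in>UNIV. dist (?A n x) (step F x) < e"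
      by (auto simp: eventually_sequentially)
  qed
qed auto

lemma fixed_point_exists: "\<exists>F. admissible F \<and> continuous_on UNIV F \<and> step F = F"
proof -
  define S :: "(real \<Rightarrow>\<^sub>C real) set" where "S = PiC UNIV (\<lambda>x. if x \<in> {0<..<1} then {0..1} else {0})"
  have S_iff: "F \<in> S \<longleftrightarrow> admissible (apply_bcontfun F)" for F
    unfolding S_def mem_PiC_iff Pi_iff admissible_def
    by (auto split: if_splits) (metis order.refl zero_le_one)+
  have bcont: "step F \<in> bcontfun" if "admissible F" "continuous_on UNIV F" for F
  proof -
    have "range (step F) \<subseteq> {0..1}" using step_admissible[OF that(1)] by (auto simp: admissible_def)
    then have "bounded (range (step F))" using bounded_closed_interval bounded_subset by blast
    then show ?thesis using step_continuous[OF that] by (simp add: bcontfun_def)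
  qed
  define \<Psi> :: "(real \<Rightarrow>\<^sub>C real) \<Rightarrow> (real \<Rightarrow>\<^sub>C real)" where "\<Psi> F = Bcontfun (step (apply_bcontfun F))" for F
  have \<Psi>: "apply_bcontfun (\<Psi> F) = step (apply_bcontfun F)" if "F \<in> S" for F
    unfolding \<Psi>_def using that by (intro Bcontfun_inverse bcont) (auto simp: S_iff)
  \<comment> \<open>heights are at most \<open>1 / 2\<close>, so the operator halves distances\<close>
  have "\<exists>!F\<in>S. \<Psi> F = F"
  proof (rule Banach_fix[where c = "1/2"])
    have "closed S" unfolding S_def by (rule closed_PiC) auto
    then show "complete S" by (simp add: complete_eq_closed)
    have "const_bcontfun 0 \<in> S" by (auto simp: S_iff admissible_def const_bcontfun.rep_eq)
    then show "S \<noteq> {}" by auto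
    show "\<Psi> ` S \<subseteq> S" using \<Psi> step_admissible by (auto simp: S_iff)
    fix F G assume "F \<in> S" "G \<in> S"
    then show "dist (\<Psi> F) (\<Psi> G) \<le> 1 / 2 * dist F G"
      using step_contraction[of "apply_bcontfun F" "apply_bcontfun G" "dist F G"] dist_bounded[of F _ G]
      by (intro dist_bound) (auto simp: \<Psi> dist_real_def)
  qed simp_all
  then obtain F where "F \<in> S" "\<Psi> F = F" by auto
  then show ?thesis using \<Psi>[of F] by (intro exI[of _ "apply_bcontfun F"]) (auto simp: S_iff)
qed

definition T :: "real \<Rightarrow> real" where
  "T = (SOME F. admissible F \<and> continuous_on UNIV F \<and> step F = F)"

lemma T_admissible: "admissible T" and T_continuous: "continuous_on A T" and T_fixed: "step T = T"
proof -
  have *: "admissible T \<and> continuous_on UNIV T \<and> step T = T"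
    unfolding T_def using fixed_point_exists by (rule someI_ex)
  then show "admissible T" "continuous_on A T" "step T = T"
    using continuous_on_subset[of UNIV T A] by auto
qed

lemma T_bounds: "0 \<le> T x" "T x \<le> 1"
  using T_admissible by (auto simp: admissible_def)

lemma T_0: "T 0 = 0" and T_1: "T 1 = 0"
  using T_admissible by (auto simp: admissible_def)

lemma T_reflect: "T (1 - x) = T x"
proof -
  have "step T (1 - x) = step T x" by (simp only: step_def tent_reflect)
  then show ?thesis by (simp add: T_fixed)
qed

lemma T_regular:
  assumes "0 \<le> u" "u \<le> 1 / 2" "\<And>i. u \<notin> gap i"
  shows "T u = L u"
proof -
  have "tent u = u" using assms by (simp add: tent_id)
  moreover from this have "step T u = L (tent u)" using assms(3) by (intro step_regular) simp
  ultimately show ?thesis by (simp add: T_fixed)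
qed

lemma T_lo: assumes "0 \<le> y" "y \<le> 1" shows "T (lo y) = y"
proof -
  have L: "L (lo y) = y" using assms by (intro L_eqI) (auto simp: lo_le_hi)
  have "lo y \<notin> gap i" for i using L L_gap[of i "lo y"] by auto
  then show ?thesis
    using T_regular[of "lo y"] L lo_nonneg[of y] lo_le_hi[of y] hi_le_half[of y] assms by auto
qed

lemma T_hi: assumes "0 \<le> y" "y \<le> 1" shows "T (hi y) = y"
proof -
  have L: "L (hi y) = y" using assms by (intro L_eqI) (auto simp: lo_le_hi)
  have "hi y \<notin> gap i" for i using L L_gap[of i "hi y"] by auto
  then show ?thesis
    using T_regular[of "hi y"] L lo_nonneg[of y] lo_le_hi[of y] hi_le_half[of y] assms by auto
qed

lemma T_half: "T (1 / 2) = 1"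
  using T_hi[of 1] hi_1 by simp

text \<open>
  The self-similarity of \<open>T\<close> in a gap of the left half, and in the mirrored gap of the right half
  (\<open>T_copy_reflect\<close>). By symmetry both copies can be traversed from left to right, so that they
  preserve the distinction between left and right.
\<close>

lemma T_copy:
  assumes "0 \<le> x" "x \<le> 1"
  shows "T (lo (\<beta> i) + g i * x) = \<beta> i - h i * T x"
proof (cases "x \<in> {0<..<1}")
  case True
  let ?u = "lo (\<beta> i) + g i * x"
  have p: "pos i ?u = x" using g_pos[of i] by (simp add: pos_def)
  then have u: "?u \<in> gap i" using True pos_gap_iff[of i ?u] by auto
  then have "tent ?u = ?u" using gap_subset[OF u] by (intro tent_id) auto
  then show ?thesis using step_gap[of ?u i T] u p by (simp add: T_fixed)
next
  case False
  then consider "x = 0" | "x = 1" using assms by force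
  then show ?thesis
    using T_lo[of "\<beta> i"] T_hi[of "\<beta> i"] T_0 T_1 level_pos[of i] level_less[of i]
    by cases (auto simp: hi_level[symmetric])
qed

lemma T_copy_reflect:
  assumes "0 \<le> x" "x \<le> 1"
  shows "T (1 - hi (\<beta> i) + g i * x) = \<beta> i - h i * T x"
proof -
  have "T (1 - hi (\<beta> i) + g i * x) = T (1 - (1 - hi (\<beta> i) + g i * x))" by (rule T_reflect[symmetric])
  also have "1 - (1 - hi (\<beta> i) + g i * x) = lo (\<beta> i) + g i * (1 - x)"
    by (simp add: hi_level algebra_simps)
  finally show ?thesis using T_copy[of "1 - x" i] T_reflect[of x] assms by simp
qed

end

section \<open>One-sided behaviour\<close>

definition flat_right :: "(real \<Rightarrow> real) \<Rightarrow> real \<Rightarrow> bool" where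
  "flat_right F t \<longleftrightarrow> (\<exists>C. \<forall>\<delta>>0. \<exists>x\<in>unit_I. t < x \<and> x < t + \<delta> \<and> \<bar>F x - F t\<bar> \<le> C * (x - t))"

definition steep_right :: "(real \<Rightarrow> real) \<Rightarrow> real \<Rightarrow> bool" where
  "steep_right F t \<longleftrightarrow> (\<forall>N. \<forall>\<delta>>0. \<exists>x\<in>unit_I. t < x \<and> x < t + \<delta> \<and> N * (x - t) \<le> \<bar>F x - F t\<bar>)"

context gap_data
begin

text \<open>
  An affine copy of the whole graph of \<open>T\<close> inside itself, over \<open>{p..p + w}\<close>, with slopes multiplied
  by \<open>r / w\<close>. As \<open>w > 0\<close>, right-hand behaviour is carried over to right-hand behaviour.
\<close>

definition copy :: "real \<Rightarrow> real \<Rightarrow> real \<Rightarrow> real \<Rightarrow> bool" where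
  "copy p w q r \<longleftrightarrow> 0 \<le> p \<and> 0 < w \<and> p + w \<le> 1 \<and> r \<noteq> 0 \<and> (\<forall>x\<in>unit_I. T (p + w * x) = q + r * T x)"

lemma copy_gap: "copy (lo (\<beta> i)) (g i) (\<beta> i) (- h i)"
  using T_copy[of _ i] g_pos[of i] height_pos[of i] lo_nonneg[of "\<beta> i"] level_pos[of i]
    hi_le_half[of "\<beta> i"] level_less[of i] hi_level[of i]
  by (auto simp: copy_def)

lemma copy_gap_reflect: "copy (1 - hi (\<beta> i)) (g i) (\<beta> i) (- h i)"
  using T_copy_reflect[of _ i] g_pos[of i] height_pos[of i] lo_nonneg[of "\<beta> i"] level_pos[of i]
    hi_le_half[of "\<beta> i"] level_less[of i] hi_level[of i]
  by (auto simp: copy_def)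

lemma copy_pos: "copy p w q r \<Longrightarrow> x \<in> unit_I \<Longrightarrow> p + w * x \<in> unit_I"
proof -
  assume c: "copy p w q r" and x: "x \<in> unit_I"
  have "0 \<le> w * x" "w * x \<le> w" using c x by (auto simp: copy_def mult_left_le)
  moreover have "0 \<le> p" "p + w \<le> 1" using c by (auto simp: copy_def)
  ultimately have "0 \<le> p + w * x" "p + w * x \<le> 1" by linarith+
  then show ?thesis by simp
qed

lemma copy_compose:
  assumes "copy p w q r" "copy p' w' q' r'"
  shows "copy (p + w * p') (w * w') (q + r * q') (r * r')"
proof -
  have "0 \<le> w * p'" "w * (p' + w') \<le> w * 1" using assms by (auto simp: copy_def intro!: mult_left_mono)
  moreover have "T (p + w * p' + w * w' * x) = q + r * q' + r * r' * T x" if x: "x \<in> unit_I" for x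
  proof -
    have "T (p + w * (p' + w' * x)) = q + r * T (p' + w' * x)"
      using assms(1) copy_pos[OF assms(2) x] by (auto simp: copy_def)
    also have "T (p' + w' * x) = q' + r' * T x" using assms(2) x by (auto simp: copy_def)
    finally show ?thesis by (simp add: algebra_simps)
  qed
  ultimately show ?thesis using assms by (auto simp: copy_def algebra_simps)
qed

lemma flat_right_copy:
  assumes "copy p w q r" "0 \<le> t" "t < 1" "flat_right T t"
  shows "flat_right T (p + w * t)"
proof -
  have w: "0 < w" and T: "\<And>x. x \<in> unit_I \<Longrightarrow> T (p + w * x) = q + r * T x"
    using assms(1) by (auto simp: copy_def)
  obtain C where C: "\<And>\<delta>. \<delta> > 0 \<Longrightarrow> \<exists>x\<in>unit_I. t < x \<and> x < t + \<delta> \<and> \<bar>T x - T t\<bar> \<le> C * (x - t)"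
    using assms(4) by (auto simp: flat_right_def)
  show ?thesis
    unfolding flat_right_def
  proof (intro exI[of _ "\<bar>r\<bar> * C / w"] allI impI)
    fix \<delta> :: real assume "0 < \<delta>"
    then obtain x where x: "x \<in> unit_I" "t < x" "x < t + \<delta> / w" "\<bar>T x - T t\<bar> \<le> C * (x - t)"
      using C[of "\<delta> / w"] w by auto
    have "w * x < w * t + \<delta>" using x(3) w by (simp add: field_simps)
    moreover have "\<bar>T (p + w * x) - T (p + w * t)\<bar> = \<bar>r\<bar> * \<bar>T x - T t\<bar>"
      using T[of x] T[of t] x assms by (simp add: abs_mult[symmetric] right_diff_distrib)
    moreover have "\<bar>r\<bar> * \<bar>T x - T t\<bar> \<le> \<bar>r\<bar> * (C * (x - t))" using x by (intro mult_left_mono) auto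
    moreover have "\<bar>r\<bar> * (C * (x - t)) = \<bar>r\<bar> * C / w * ((p + w * x) - (p + w * t))"
      using w by (simp add: field_simps)
    ultimately show "\<exists>x\<in>unit_I. p + w * t < x \<and> x < p + w * t + \<delta> \<and>
          \<bar>T x - T (p + w * t)\<bar> \<le> \<bar>r\<bar> * C / w * (x - (p + w * t))"
      using copy_pos[OF assms(1) x(1)] x(2) w by (intro bexI[of _ "p + w * x"]) auto
  qed
qed

lemma steep_right_copy:
  assumes "copy p w q r" "0 \<le> t" "t < 1" "steep_right T t"
  shows "steep_right T (p + w * t)"
  unfolding steep_right_def
proof (intro allI impI)
  have w: "0 < w" and r: "r \<noteq> 0" and T: "\<And>x. x \<in> unit_I \<Longrightarrow> T (p + w * x) = q + r * T x"
    using assms(1) by (auto simp: copy_def)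
  fix N \<delta> :: real assume "0 < \<delta>"
  then obtain x where x: "x \<in> unit_I" "t < x" "x < t + \<delta> / w" "N * w / \<bar>r\<bar> * (x - t) \<le> \<bar>T x - T t\<bar>"
    using assms(4) w unfolding steep_right_def by (meson divide_pos_pos)
  have "w * x < w * t + \<delta>" using x(3) w by (simp add: field_simps)
  moreover have "\<bar>T (p + w * x) - T (p + w * t)\<bar> = \<bar>r\<bar> * \<bar>T x - T t\<bar>"
    using T[of x] T[of t] x assms by (simp add: abs_mult[symmetric] right_diff_distrib)
  moreover have "\<bar>r\<bar> * (N * w / \<bar>r\<bar> * (x - t)) \<le> \<bar>r\<bar> * \<bar>T x - T t\<bar>" using x by (intro mult_left_mono) auto
  moreover have "\<bar>r\<bar> * (N * w / \<bar>r\<bar> * (x - t)) = N * ((p + w * x) - (p + w * t))"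
    using r by (simp add: field_simps)
  ultimately show "\<exists>x\<in>unit_I. p + w * t < x \<and> x < p + w * t + \<delta> \<and>
        N * (x - (p + w * t)) \<le> \<bar>T x - T (p + w * t)\<bar>"
    using copy_pos[OF assms(1) x(1)] x(2) w by (intro bexI[of _ "p + w * x"]) auto
qed

subsection \<open>Points in gaps\<close>

definition in_gap :: "real \<Rightarrow> bool" where
  "in_gap t \<longleftrightarrow> (\<exists>i. t \<in> gap i \<or> 1 - t \<in> gap i)"

lemma in_gap_copy:
  assumes "in_gap t"
  obtains i p x where "0 < x" "x < 1" "t = p + g i * x" "copy p (g i) (\<beta> i) (- h i)"
proof -
  obtain i where "t \<in> gap i \<or> 1 - t \<in> gap i" using assms by (auto simp: in_gap_def)
  then show thesis
  proof
    assume t: "t \<in> gap i"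
    show thesis
    proof (rule that)
      show "0 < pos i t" "pos i t < 1" using t pos_gap_iff[of i t] by auto
      show "t = lo (\<beta> i) + g i * pos i t" using g_pos[of i] by (simp add: pos_def)
    qed (rule copy_gap)
  next
    assume t: "1 - t \<in> gap i"
    show thesis
    proof (rule that)
      show "0 < 1 - pos i (1 - t)" "1 - pos i (1 - t) < 1" using t pos_gap_iff[of i "1 - t"] by auto
      show "t = (1 - hi (\<beta> i)) + g i * (1 - pos i (1 - t))"
        using g_pos[of i] by (simp add: pos_def hi_level field_simps)
    qed (rule copy_gap_reflect)
  qed
qed

text \<open>
  In the left half the value recurs at \<open>1 - t\<close>. In the right half \<open>T t\<close> lies below the tread of the
  gap that contains \<open>t\<close>, hence between the values of \<open>T\<close> at the right end of this gap and at \<open>1\<close>.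
\<close>

lemma return_in_gap:
  assumes "in_gap t"
  shows "\<exists>x. t < x \<and> x \<le> 1 \<and> T x = T t"
proof -
  obtain i where "t \<in> gap i \<or> 1 - t \<in> gap i" using assms by (auto simp: in_gap_def)
  then show ?thesis
  proof
    assume "t \<in> gap i"
    then show ?thesis using gap_subset[of t i] T_reflect[of t] by (intro exI[of _ "1 - t"]) auto
  next
    assume t: "1 - t \<in> gap i"
    define x where "x = pos i (1 - t)"
    have x: "0 < x" "x < 1" using t pos_gap_iff[of i "1 - t"] by (auto simp: x_def)
    have "T (1 - t) = \<beta> i - h i * T x"
      using T_copy[of x i] x g_pos[of i] by (simp add: x_def pos_def)
    moreover have "0 \<le> h i * T x" using T_bounds height_pos[of i] by simp
    ultimately have "T t \<le> \<beta> i" by (simp add: T_reflect)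
    moreover have "T (1 - lo (\<beta> i)) = \<beta> i"
      using T_lo[of "\<beta> i"] level_pos[of i] level_less[of i] by (simp add: T_reflect)
    moreover have "1 - lo (\<beta> i) \<le> 1" using lo_nonneg[of "\<beta> i"] level_pos[of i] by simp
    ultimately have "\<exists>x. 1 - lo (\<beta> i) \<le> x \<and> x \<le> 1 \<and> T x = T t"
      by (intro IVT2') (auto simp: T_1 T_bounds T_continuous)
    then show ?thesis using t by force
  qed
qed

text \<open>
  A secant of slope at least \<open>1 / 2\<close> starts at every point of a gap. In the left half it goes to the
  apex or to \<open>1\<close>. In the right half \<open>t\<close> sits at some point \<open>x\<close> of a hanging copy. If \<open>T x\<close> is small
  then \<open>T t\<close> is comparable with the level of the gap, and so with \<open>1 - t\<close>, and the secant goes to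
  \<open>1\<close>; otherwise the copy hangs far down at \<open>t\<close> and the secant goes to the right end of the gap.
\<close>

lemma slope_in_gap:
  assumes "in_gap t"
  shows "\<exists>x. t < x \<and> x \<le> 1 \<and> 1 / 2 * (x - t) \<le> \<bar>T x - T t\<bar>"
proof -
  obtain i where "t \<in> gap i \<or> 1 - t \<in> gap i" using assms by (auto simp: in_gap_def)
  then show ?thesis
  proof
    assume t: "t \<in> gap i"
    show ?thesis
    proof (cases "T t \<le> 1 / 2")
      case True
      then show ?thesis using gap_subset[OF t] T_half by (intro exI[of _ "1 / 2"]) auto
    next
      case False
      then show ?thesis using gap_subset[OF t] T_1 by (intro exI[of _ 1]) auto
    qed
  next
    assume t: "1 - t \<in> gap i"
    define x where "x = pos i (1 - t)"
    have x: "0 < x" "x < 1" using t pos_gap_iff[of i "1 - t"] by (auto simp: x_def)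
    have "T (1 - t) = \<beta> i - h i * T x"
      using T_copy[of x i] x g_pos[of i] by (simp add: x_def pos_def)
    then have Tt: "T t = \<beta> i - h i * T x" by (simp add: T_reflect)
    show ?thesis
    proof (cases "T x \<le> 1 / 2")
      case True
      have "h i * T x \<le> \<beta> i * (1 / 2)"
        using True T_bounds height_pos[of i] height_le_level[of i] by (intro mult_mono) auto
      moreover have "1 - t \<le> \<beta> i" using t hi_le[of "\<beta> i"] level_pos[of i] level_less[of i] by auto
      ultimately show ?thesis using Tt T_1 gap_subset[OF t] by (intro exI[of _ 1]) auto
    next
      case False
      define d where "d = h i * T x"
      have "h i * (1 / 2) \<le> d" unfolding d_def using False height_pos[of i] by (intro mult_left_mono) auto
      moreover have "T t = \<beta> i - d" using Tt by (simp add: d_def)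
      moreover have "T (1 - lo (\<beta> i)) = \<beta> i"
        using T_lo[of "\<beta> i"] level_pos[of i] level_less[of i] by (simp add: T_reflect)
      moreover have "1 - lo (\<beta> i) - t \<le> h i / 4"
        using t hi_level[of i] g_le_height[of i] by auto
      then have "1 - lo (\<beta> i) - t \<le> h i" using height_pos[of i] by linarith
      ultimately have "1 / 2 * (1 - lo (\<beta> i) - t) \<le> T (1 - lo (\<beta> i)) - T t" by simp
      then have "1 / 2 * (1 - lo (\<beta> i) - t) \<le> \<bar>T (1 - lo (\<beta> i)) - T t\<bar>" by linarith
      then show ?thesis using t lo_nonneg[of "\<beta> i"] level_pos[of i]
        by (intro exI[of _ "1 - lo (\<beta> i)"] conjI) auto
    qed
  qed
qed

text \<open>
  Zooming into the gap that contains the point, again and again: either this stops at a point outside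
  the gaps, or there are copies of arbitrarily high order around \<open>t\<close>, each at least four times as
  narrow and four times as steep as the preceding one.
\<close>

lemma nested_copies:
  assumes "0 < t" "t < 1"
  shows "(\<exists>p w q r x. copy p w q r \<and> 0 < x \<and> x < 1 \<and> t = p + w * x \<and> \<not> in_gap x) \<or>
     (\<exists>p w q r x. copy p w q r \<and> 0 < x \<and> x < 1 \<and> t = p + w * x \<and> in_gap x \<and>
        w \<le> (1 / 4) ^ n \<and> 4 ^ n * w \<le> \<bar>r\<bar>)"
    (is "?A \<or> ?B n")
proof (induction n)
  case 0
  have "copy 0 1 0 1" by (simp add: copy_def)
  then show ?case using assms by (cases "in_gap t") force+
next
  case (Suc n)
  show ?case
  proof (cases ?A)
    case False
    then obtain p w q r x where c: "copy p w q r" "0 < x" "x < 1" "t = p + w * x" "in_gap x"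
      "w \<le> (1 / 4) ^ n" "4 ^ n * w \<le> \<bar>r\<bar>" using Suc.IH by blast
    obtain i p' x' where c': "0 < x'" "x' < 1" "x = p' + g i * x'" "copy p' (g i) (\<beta> i) (- h i)"
      using in_gap_copy[OF c(5)] by metis
    have cc: "copy (p + w * p') (w * g i) (q + r * \<beta> i) (r * - h i)"
      by (rule copy_compose[OF c(1) c'(4)])
    have t: "t = (p + w * p') + (w * g i) * x'" using c(4) c'(3) by (simp add: algebra_simps)
    have "g i \<le> 1 / 4" using g_le_height[of i] height_le_half[of i] by simp
    then have "w * g i \<le> (1 / 4) ^ n * (1 / 4)" using c g_pos[of i] by (intro mult_mono) (auto simp: copy_def)
    then have w: "w * g i \<le> (1 / 4) ^ Suc n" by simp
    have "4 ^ n * w * (4 * g i) \<le> \<bar>r\<bar> * h i"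
      using c(7) g_le_height[of i] g_pos[of i] by (intro mult_mono) auto
    then have r: "4 ^ Suc n * (w * g i) \<le> \<bar>r * - h i\<bar>" using height_pos[of i] by (simp add: abs_mult algebra_simps)
    show ?thesis
    proof (cases "in_gap x'")
      case True
      then have "?B (Suc n)" using cc t c'(1,2) w r by blast
      then show ?thesis ..
    next
      case False
      then have ?A using cc t c'(1,2) by blast
      then show ?thesis ..
    qed
  qed simp
qed

lemma deep_flat:
  assumes "\<And>n. \<exists>p w q r x. copy p w q r \<and> 0 < x \<and> x < 1 \<and> t = p + w * x \<and> in_gap x \<and>
        w \<le> (1 / 4) ^ n \<and> 4 ^ n * w \<le> \<bar>r\<bar>"
  shows "flat_right T t"
  unfolding flat_right_def
proof (intro exI[of _ 0] allI impI)
  fix \<delta> :: real assume "0 < \<delta>"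
  then obtain n where n: "(1 / 4) ^ n < \<delta>" using real_arch_pow_inv[of \<delta> "1 / 4"] by auto
  obtain p w q r x where c: "copy p w q r" "0 < x" "x < 1" "t = p + w * x" "in_gap x" "w \<le> (1 / 4) ^ n"
    using assms[of n] by blast
  obtain x' where x': "x < x'" "x' \<le> 1" "T x' = T x" using return_in_gap[OF c(5)] by auto
  have "T (p + w * x') = T (p + w * x)" using c x' by (auto simp: copy_def)
  moreover have "w * (x' - x) \<le> w * 1" using c x' by (intro mult_left_mono) (auto simp: copy_def)
  moreover have "0 < w * (x' - x)" using c x' by (auto simp: copy_def)
  ultimately show "\<exists>y\<in>unit_I. t < y \<and> y < t + \<delta> \<and> \<bar>T y - T t\<bar> \<le> 0 * (y - t)"
    using copy_pos[OF c(1), of x'] c x' n by (intro bexI[of _ "p + w * x'"]) (auto simp: algebra_simps)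
qed

lemma deep_steep:
  assumes "\<And>n. \<exists>p w q r x. copy p w q r \<and> 0 < x \<and> x < 1 \<and> t = p + w * x \<and> in_gap x \<and>
        w \<le> (1 / 4) ^ n \<and> 4 ^ n * w \<le> \<bar>r\<bar>"
  shows "steep_right T t"
  unfolding steep_right_def
proof (intro allI impI)
  fix N \<delta> :: real assume "0 < \<delta>"
  then obtain n1 where n1: "(1 / 4) ^ n1 < \<delta>" using real_arch_pow_inv[of \<delta> "1 / 4"] by auto
  obtain n2 where n2: "2 * N < 4 ^ n2" using real_arch_pow[of 4 "2 * N"] by auto
  define n where "n = max n1 n2"
  have n: "(1 / 4) ^ n < \<delta>" "2 * N < 4 ^ n"
  proof -
    have "(1 / 4 :: real) ^ n \<le> (1 / 4) ^ n1" by (rule power_decreasing) (auto simp: n_def)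
    then show "(1 / 4) ^ n < \<delta>" using n1 by linarith
    have "(4 :: real) ^ n2 \<le> 4 ^ n" by (rule power_increasing) (auto simp: n_def)
    then show "2 * N < 4 ^ n" using n2 by linarith
  qed
  obtain p w q r x where c: "copy p w q r" "0 < x" "x < 1" "t = p + w * x" "in_gap x" "w \<le> (1 / 4) ^ n"
    "4 ^ n * w \<le> \<bar>r\<bar>"
    using assms[of n] by blast
  obtain x' where x': "x < x'" "x' \<le> 1" "1 / 2 * (x' - x) \<le> \<bar>T x' - T x\<bar>" using slope_in_gap[OF c(5)] by auto
  have "T (p + w * x') = q + r * T x'" "T (p + w * x) = q + r * T x" using c x' by (auto simp: copy_def)
  then have eq: "\<bar>T (p + w * x') - T (p + w * x)\<bar> = \<bar>r\<bar> * \<bar>T x' - T x\<bar>"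
    by (simp add: abs_mult[symmetric] right_diff_distrib)
  have w: "w * (x' - x) \<le> w * 1" using c x' by (intro mult_left_mono) (auto simp: copy_def)
  have w0: "0 < w * (x' - x)" using c x' by (auto simp: copy_def)
  have "N * (w * (x' - x)) \<le> 4 ^ n / 2 * (w * (x' - x))" using n w0 by (intro mult_right_mono) auto
  also have "\<dots> = (4 ^ n * w) * (1 / 2 * (x' - x))" by simp
  also have "\<dots> \<le> \<bar>r\<bar> * \<bar>T x' - T x\<bar>" using c x' by (intro mult_mono) auto
  finally have "N * ((p + w * x') - t) \<le> \<bar>T (p + w * x') - T t\<bar>" using eq c(4) by (simp add: algebra_simps)
  then show "\<exists>y\<in>unit_I. t < y \<and> y < t + \<delta> \<and> N * (y - t) \<le> \<bar>T y - T t\<bar>"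
    using copy_pos[OF c(1), of x'] c x' n w w0 by (intro bexI[of _ "p + w * x'"]) (auto simp: algebra_simps)
qed

subsection \<open>Regular points\<close>

text \<open>
  The heights tend to \<open>0\<close>, so only finitely many are at least \<open>h k\<close>.
\<close>

lemma tallest_level:
  assumes "\<beta> k \<in> A"
  shows "\<exists>i. \<beta> i \<in> A \<and> h k \<le> h i \<and> (\<forall>j. \<beta> j \<in> A \<longrightarrow> h j \<le> h i)"
proof -
  let ?K = "{j. \<beta> j \<in> A \<and> h k \<le> h j}"
  have "\<forall>\<^sub>F j in sequentially. h j < h k"
    using order_tendstoD(2)[OF height_tendsto height_pos] .
  then obtain J where "\<And>j. J \<le> j \<Longrightarrow> h j < h k" by (auto simp: eventually_sequentially)
  then have "?K \<subseteq> {..<J}" by (auto simp: not_less[symmetric])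
  then have fin: "finite (h ` ?K)" by (auto intro: finite_subset)
  then have "Max (h ` ?K) \<in> h ` ?K" using assms by (intro Max_in) auto
  then obtain i where i: "i \<in> ?K" "h i = Max (h ` ?K)" by auto
  have "h j \<le> h i" if "\<beta> j \<in> A" for j
    using that i fin by (cases "h k \<le> h j") auto
  then show ?thesis using i by auto
qed

lemma T_mid: "T (lo (\<beta> i) + g i / 2) = \<beta> i - h i"
  using T_copy[of "1 / 2" i] T_half by simp

text \<open>
  Between the levels \<open>y\<close> and \<open>z\<close> the staircase covers a horizontal distance of at least a constant
  multiple of \<open>y * (z - y)\<close>; so its points at levels just above \<open>y\<close> give bounded quotients.
\<close>

lemma flat_hi:
  assumes y: "0 < y" "y < 1"
  shows "flat_right T (hi y)"
  unfolding flat_right_def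
proof (intro exI[of _ "4 / y"] allI impI)
  fix \<delta> :: real assume "0 < \<delta>"
  then obtain \<delta>' where d: "\<delta>' > 0" "\<And>y1 y2. 0 \<le> y1 \<Longrightarrow> y1 < y2 \<Longrightarrow> y2 \<le> 1 \<Longrightarrow> y \<notin> {y1<..<y2} \<Longrightarrow>
      \<bar>y1 - y\<bar> < \<delta>' \<Longrightarrow> \<bar>y2 - y\<bar> < \<delta>' \<Longrightarrow> lo y2 - hi y1 < \<delta>"
    using lo_hi_close[of \<delta> y] y by (metis less_imp_le)
  define z where "z = min 1 (y + \<delta>' / 2)"
  have z: "y < z" "z \<le> 1" "\<bar>z - y\<bar> < \<delta>'" using d(1) y by (auto simp: z_def)
  have "lo z - hi y < \<delta>" using d z y by (intro d(2)) auto
  moreover have "hi y < lo z" using hi_less_lo y z by auto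
  moreover have "\<bar>T (lo z) - T (hi y)\<bar> \<le> 4 / y * (lo z - hi y)"
  proof -
    have "y / 4 * (z - y) \<le> z / 4 * (z - y)" using z by (intro mult_right_mono) auto
    also have "\<dots> \<le> lo z - hi y"
      using kappa_squares_ge[of y z] hi_lo_quadratic[of y z] z y by linarith
    finally have "z - y \<le> 4 / y * (lo z - hi y)" using y by (simp add: field_simps)
    then show ?thesis using T_lo[of z] T_hi[of y] y z by auto
  qed
  moreover have "lo z \<in> unit_I" using lo_nonneg[of z] lo_le_hi[of z] hi_le_half[of z] y z by auto
  ultimately show "\<exists>x\<in>unit_I. hi y < x \<and> x < hi y + \<delta> \<and> \<bar>T x - T (hi y)\<bar> \<le> 4 / y * (x - hi y)"
    by (intro bexI[of _ "lo z"]) auto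
qed

lemma flat_lo:
  assumes y: "0 < y" "y \<le> 1"
  shows "flat_right T (1 - lo y)"
  unfolding flat_right_def
proof (intro exI[of _ "4 / y"] allI impI)
  fix \<delta> :: real assume "0 < \<delta>"
  then obtain \<delta>' where d: "\<delta>' > 0" "\<And>y1 y2. 0 \<le> y1 \<Longrightarrow> y1 < y2 \<Longrightarrow> y2 \<le> 1 \<Longrightarrow> y \<notin> {y1<..<y2} \<Longrightarrow>
      \<bar>y1 - y\<bar> < \<delta>' \<Longrightarrow> \<bar>y2 - y\<bar> < \<delta>' \<Longrightarrow> lo y2 - hi y1 < \<delta>"
    using lo_hi_close[of \<delta> y] y by (metis less_imp_le)
  define z where "z = max 0 (y - \<delta>' / 2)"
  have z: "z < y" "0 \<le> z" "\<bar>z - y\<bar> < \<delta>'" using d(1) y by (auto simp: z_def)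
  have "lo y - hi z < \<delta>" using d z y by (intro d(2)) auto
  moreover have "hi z < lo y" using hi_less_lo y z by auto
  moreover have "\<bar>T (1 - hi z) - T (1 - lo y)\<bar> \<le> 4 / y * (lo y - hi z)"
  proof -
    have "y / 4 * (y - z) \<le> lo y - hi z"
      using kappa_squares_ge[of z y] hi_lo_quadratic[of z y] z y by linarith
    then have "y - z \<le> 4 / y * (lo y - hi z)" using y by (simp add: field_simps)
    then show ?thesis using T_lo[of y] T_hi[of z] y z by (auto simp: T_reflect)
  qed
  moreover have "1 - hi z \<in> unit_I" using lo_nonneg[of z] lo_le_hi[of z] hi_le_half[of z] y z by auto
  ultimately show "\<exists>x\<in>unit_I. 1 - lo y < x \<and> x < 1 - lo y + \<delta> \<and> \<bar>T x - T (1 - lo y)\<bar> \<le> 4 / y * (x - (1 - lo y))"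
    by (intro bexI[of _ "1 - hi z"]) auto
qed

lemma steep_estimate:
  fixes N :: real
  assumes M: "4 * (\<bar>N\<bar> + 1) = M" and hpos: "0 < H" and close: "M * e \<le> H" "0 \<le> e"
    and dist: "d \<le> e + H / M" "0 \<le> d"
  shows "N * d \<le> H - e"
proof -
  have M4: "4 \<le> M" using M by auto
  have e: "e \<le> H / M" using close M4 by (simp add: field_simps)
  have "N * d \<le> \<bar>N\<bar> * (2 * (H / M))" using dist e by (intro mult_mono) auto
  also have "\<dots> = H / 2 - 2 * H / M" using M4 M by (auto simp: field_simps)
  also have "\<dots> \<le> H - e"
  proof -
    have "0 \<le> H / M" using hpos M4 by simp
    then show ?thesis using e hpos by simp
  qed
  finally show ?thesis .
qed

text \<open>
  Among the gaps between \<open>y\<close> and a level \<open>\<beta> k\<close> provided by the covering condition, take a tallest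
  one and go to the lowest point of its copy. The vertical distance is about \<open>h i\<close>. The horizontal
  distance is made up of the part outside the gaps, at most \<open>\<beta> i - y\<close>, and of gaps that are no
  taller, whose total length is a small multiple of \<open>h i\<close>.
\<close>

lemma steep_hi:
  assumes y: "0 < y" "y < 1"
  shows "steep_right T (hi y)"
  unfolding steep_right_def
proof (intro allI impI)
  fix N \<delta> :: real assume "0 < \<delta>"
  \<comment> \<open>the slope to be reached is \<open>N\<close>, and \<open>M\<close> leaves room for the two contributions to the distance\<close>
  define M where "M = 4 * (\<bar>N\<bar> + 1)"
  have M4: "4 \<le> M" by (auto simp: M_def)
  obtain \<delta>1 where d1: "\<delta>1 > 0" "weight \<rho> {x. x \<noteq> y \<and> \<bar>x - y\<bar> < \<delta>1} \<le> 1 / M"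
    using weight_ratio_small[of "1 / M" y] M4 by auto
  obtain \<delta>' where d: "\<delta>' > 0" "\<And>y1 y2. 0 \<le> y1 \<Longrightarrow> y1 < y2 \<Longrightarrow> y2 \<le> 1 \<Longrightarrow> y \<notin> {y1<..<y2} \<Longrightarrow>
      \<bar>y1 - y\<bar> < \<delta>' \<Longrightarrow> \<bar>y2 - y\<bar> < \<delta>' \<Longrightarrow> lo y2 - hi y1 < \<delta>"
    using lo_hi_close[of \<delta> y] y \<open>0 < \<delta>\<close> by (metis less_imp_le)
  \<comment> \<open>gaps at levels below \<open>z\<close> end within distance \<open>\<delta>\<close> of \<open>hi y\<close>\<close>
  define z where "z = min 1 (y + \<delta>' / 2)"
  have z: "y < z" "z \<le> 1" "\<bar>z - y\<bar> < \<delta>'" using d(1) y by (auto simp: z_def)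
  obtain k where k: "y < \<beta> k" "\<beta> k < y + min \<delta>1 (z - y)" "M * (\<beta> k - y) \<le> h k"
    using cover_right[of y "min \<delta>1 (z - y)" M] y z d1 by auto
  obtain i where i: "\<beta> i \<in> {y<..\<beta> k}" "h k \<le> h i" "\<And>j. \<beta> j \<in> {y<..\<beta> k} \<Longrightarrow> h j \<le> h i"
    using tallest_level[of k "{y<..\<beta> k}"] k by auto
  have close: "M * (\<beta> i - y) \<le> h i"
  proof -
    have "M * (\<beta> i - y) \<le> M * (\<beta> k - y)" using i M4 by (intro mult_left_mono) auto
    then show ?thesis using k i by linarith
  qed
  let ?x = "lo (\<beta> i) + g i / 2"
  have "weight g {y<..\<beta> i} \<le> h i * weight \<rho> {y<..\<beta> i}"
    by (rule weight_le_height) (use i height_pos[of i] in auto)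
  also have "weight \<rho> {y<..\<beta> i} \<le> weight \<rho> {x. x \<noteq> y \<and> \<bar>x - y\<bar> < \<delta>1}"
    by (rule weight_ratio_mono) (use i k in auto)
  then have "weight \<rho> {y<..\<beta> i} \<le> 1 / M" using d1 by simp
  then have "h i * weight \<rho> {y<..\<beta> i} \<le> h i * (1 / M)" using height_pos[of i] by (intro mult_left_mono) auto
  finally have "hi (\<beta> i) - hi y \<le> (\<beta> i - y) + h i / M"
    using hi_minus_hi[of y "\<beta> i"] kappa_squares_le[of y "\<beta> i"] y i level_less[of i] by auto
  then have dist: "?x - hi y \<le> (\<beta> i - y) + h i / M" using hi_level[of i] g_pos[of i] by simp
  have right: "hi y < ?x" using hi_less_lo[of y "\<beta> i"] y i g_pos[of i] by auto
  have "N * (?x - hi y) \<le> h i - (\<beta> i - y)"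
    by (rule steep_estimate[OF M_def[symmetric] height_pos close _ dist]) (use i right in auto)
  also have "\<dots> \<le> \<bar>T ?x - T (hi y)\<bar>" using T_mid[of i] T_hi[of y] y by auto
  finally have "N * (?x - hi y) \<le> \<bar>T ?x - T (hi y)\<bar>" .
  moreover have "?x < hi y + \<delta>"
  proof -
    have "lo z - hi y < \<delta>" using d z y by (intro d(2)) auto
    moreover have "hi (\<beta> i) < lo z" using hi_less_lo[of "\<beta> i" z] i k level_pos[of i] by auto
    ultimately show ?thesis using hi_level[of i] g_pos[of i] by simp
  qed
  moreover have "?x \<in> unit_I"
    using hi_level[of i] g_pos[of i] hi_le_half[of "\<beta> i"] lo_nonneg[of "\<beta> i"] level_pos[of i] level_less[of i]
    by auto
  ultimately show "\<exists>x\<in>unit_I. hi y < x \<and> x < hi y + \<delta> \<and> N * (x - hi y) \<le> \<bar>T x - T (hi y)\<bar>"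
    using right by (intro bexI[of _ ?x]) auto
qed

text \<open>
  The reflection of \<open>steep_hi\<close>: on the right half the staircase descends from level \<open>y\<close>.
\<close>

lemma steep_lo:
  assumes y: "0 < y" "y \<le> 1"
  shows "steep_right T (1 - lo y)"
  unfolding steep_right_def
proof (intro allI impI)
  fix N \<delta> :: real assume "0 < \<delta>"
  define M where "M = 4 * (\<bar>N\<bar> + 1)"
  have M4: "4 \<le> M" by (auto simp: M_def)
  obtain \<delta>1 where d1: "\<delta>1 > 0" "weight \<rho> {x. x \<noteq> y \<and> \<bar>x - y\<bar> < \<delta>1} \<le> 1 / M"
    using weight_ratio_small[of "1 / M" y] M4 by auto
  obtain \<delta>' where d: "\<delta>' > 0" "\<And>y1 y2. 0 \<le> y1 \<Longrightarrow> y1 < y2 \<Longrightarrow> y2 \<le> 1 \<Longrightarrow> y \<notin> {y1<..<y2} \<Longrightarrow>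
      \<bar>y1 - y\<bar> < \<delta>' \<Longrightarrow> \<bar>y2 - y\<bar> < \<delta>' \<Longrightarrow> lo y2 - hi y1 < \<delta>"
    using lo_hi_close[of \<delta> y] y \<open>0 < \<delta>\<close> by (metis less_imp_le)
  define z where "z = max 0 (y - \<delta>' / 2)"
  have z: "z < y" "0 \<le> z" "\<bar>z - y\<bar> < \<delta>'" using d(1) y by (auto simp: z_def)
  obtain k where k: "y - min \<delta>1 (y - z) < \<beta> k" "\<beta> k < y" "M * (y - \<beta> k) \<le> h k"
    using cover_left[of y "min \<delta>1 (y - z)" M] y z d1 by auto
  obtain i where i: "\<beta> i \<in> {\<beta> k..<y}" "h k \<le> h i" "\<And>j. \<beta> j \<in> {\<beta> k..<y} \<Longrightarrow> h j \<le> h i"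
    using tallest_level[of k "{\<beta> k..<y}"] k by auto
  have close: "M * (y - \<beta> i) \<le> h i"
  proof -
    have "M * (y - \<beta> i) \<le> M * (y - \<beta> k)" using i M4 by (intro mult_left_mono) auto
    then show ?thesis using k i by linarith
  qed
  let ?x = "lo (\<beta> i) + g i / 2"
  have "weight g {\<beta> i..<y} \<le> h i * weight \<rho> {\<beta> i..<y}"
    by (rule weight_le_height) (use i height_pos[of i] in auto)
  also have "weight \<rho> {\<beta> i..<y} \<le> weight \<rho> {x. x \<noteq> y \<and> \<bar>x - y\<bar> < \<delta>1}"
    by (rule weight_ratio_mono) (use i k in auto)
  then have "weight \<rho> {\<beta> i..<y} \<le> 1 / M" using d1 by simp
  then have "h i * weight \<rho> {\<beta> i..<y} \<le> h i * (1 / M)" using height_pos[of i] by (intro mult_left_mono) auto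
  finally have "lo y - lo (\<beta> i) \<le> (y - \<beta> i) + h i / M"
    using lo_minus_lo[of "\<beta> i" y] kappa_squares_le[of "\<beta> i" y] y i level_pos[of i] by auto
  then have dist: "lo y - ?x \<le> (y - \<beta> i) + h i / M" using g_pos[of i] by simp
  have left: "?x < lo y" using hi_less_lo[of "\<beta> i" y] y i g_pos[of i] hi_level[of i] level_pos[of i] by auto
  have "N * (lo y - ?x) \<le> h i - (y - \<beta> i)"
    by (rule steep_estimate[OF M_def[symmetric] height_pos close _ dist]) (use i left in auto)
  also have "\<dots> \<le> \<bar>T (1 - ?x) - T (1 - lo y)\<bar>"
    unfolding T_reflect T_mid using T_lo[of y] y i by auto
  finally have "N * (lo y - ?x) \<le> \<bar>T (1 - ?x) - T (1 - lo y)\<bar>" .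
  moreover have "lo y < ?x + \<delta>"
  proof -
    have "lo y - hi z < \<delta>" using d z y by (intro d(2)) auto
    moreover have "hi z < lo (\<beta> i)" using hi_less_lo[of z "\<beta> i"] i k z by auto
    ultimately show ?thesis using hi_level[of i] g_pos[of i] by simp
  qed
  moreover have "?x \<in> unit_I"
    using hi_level[of i] g_pos[of i] hi_le_half[of "\<beta> i"] lo_nonneg[of "\<beta> i"] level_pos[of i] level_less[of i]
    by auto
  ultimately show "\<exists>x\<in>unit_I. 1 - lo y < x \<and> x < 1 - lo y + \<delta> \<and> N * (x - (1 - lo y)) \<le> \<bar>T x - T (1 - lo y)\<bar>"
  proof (intro bexI[of _ "1 - ?x"] conjI)
    assume *: "N * (lo y - ?x) \<le> \<bar>T (1 - ?x) - T (1 - lo y)\<bar>"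
    have "1 - ?x - (1 - lo y) = lo y - ?x" by simp
    then show "N * (1 - ?x - (1 - lo y)) \<le> \<bar>T (1 - ?x) - T (1 - lo y)\<bar>" using * by (simp only:)
  qed (use left in auto)
qed

lemma flat_0: "flat_right T 0"
  unfolding flat_right_def
proof (intro exI[of _ 0] allI impI)
  fix \<delta> :: real assume "0 < \<delta>"
  then obtain i where i: "\<beta> i < \<delta>" "h i = \<beta> i" using touching_zero by blast
  let ?x = "lo (\<beta> i) + g i / 2"
  have "0 < ?x" "?x < \<delta>" "?x \<le> 1"
    using hi_level[of i] g_pos[of i] hi_le[of "\<beta> i"] lo_nonneg[of "\<beta> i"] level_pos[of i] level_less[of i] i
    by auto
  then show "\<exists>x\<in>unit_I. 0 < x \<and> x < 0 + \<delta> \<and> \<bar>T x - T 0\<bar> \<le> 0 * (x - 0)"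
    using T_mid[of i] T_0 i by (intro bexI[of _ ?x]) auto
qed

text \<open>
  At the foot \<open>lo y / y\<close> tends to \<open>0\<close>: the part outside the gaps is quadratic in \<open>y\<close>, and the gaps
  below level \<open>y\<close> have height at most \<open>y\<close>.
\<close>

lemma steep_0: "steep_right T 0"
  unfolding steep_right_def
proof (intro allI impI)
  fix N \<delta> :: real assume "0 < \<delta>"
  define e where "e = 1 / (2 * (\<bar>N\<bar> + 1))"
  have e: "0 < e" "(\<bar>N\<bar> + 1) * (2 * e) = 1" by (auto simp: e_def)
  obtain \<delta>1 where d1: "\<delta>1 > 0" "weight \<rho> {x. x \<noteq> 0 \<and> \<bar>x - 0\<bar> < \<delta>1} \<le> e"
    using weight_ratio_small[of e 0] e by auto
  define y where "y = min (min (\<delta> / 2) (\<delta>1 / 2)) (min e 1)"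
  have y: "0 < y" "y < \<delta>" "y < \<delta>1" "y \<le> e" "y \<le> 1" using d1 e \<open>0 < \<delta>\<close> by (auto simp: y_def)
  have "weight g {0<..<y} \<le> y * weight \<rho> {0<..<y}"
    by (rule weight_le_height) (use height_le_level y in \<open>auto intro: order_trans less_imp_le\<close>)
  also have "weight \<rho> {0<..<y} \<le> weight \<rho> {x. x \<noteq> 0 \<and> \<bar>x - 0\<bar> < \<delta>1}"
    by (rule weight_ratio_mono) (use y in auto)
  then have "y * weight \<rho> {0<..<y} \<le> y * e" using d1 y by (intro mult_left_mono) auto
  finally have "weight g {0<..<y} \<le> y * e" .
  moreover have "\<kappa> * y\<^sup>2 \<le> 1 * (y * e)"
    using kappa_bounds y by (intro mult_mono) (auto simp: power2_eq_square)
  ultimately have lo: "lo y \<le> y * (2 * e)" using lo_minus_hi[of 0 y] y hi_0 by simp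
  have "N * lo y \<le> (\<bar>N\<bar> + 1) * (y * (2 * e))" using lo lo_nonneg[of y] y by (intro mult_mono) auto
  also have "\<dots> = y" using e(2) by (metis mult.left_commute mult.right_neutral)
  finally have "N * lo y \<le> y" .
  moreover have "0 < lo y" "lo y < \<delta>" "lo y \<le> 1"
    using lo_pos[of y] lo_le_hi[of y] hi_le[of y] y by auto
  ultimately show "\<exists>x\<in>unit_I. 0 < x \<and> x < 0 + \<delta> \<and> N * (x - 0) \<le> \<bar>T x - T 0\<bar>"
    using T_lo[of y] T_0 y by (intro bexI[of _ "lo y"]) auto
qed

text \<open>
  A point outside the open gaps is a one-sided limit of points of the staircase on its right, unless
  a gap begins there; in that case its right-hand side is a copy of the right-hand side of \<open>0\<close>.
\<close>

lemma regular_rough: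
  assumes t: "0 < t" "t < 1" "\<not> in_gap t"
  shows "flat_right T t \<and> steep_right T t"
proof (cases "t < 1 / 2")
  case True
  define y where "y = L t"
  have L: "0 \<le> y" "y \<le> 1" "lo y \<le> t" "t \<le> hi y" using L_props[of t] t True by (auto simp: y_def)
  have y: "0 < y" "y < 1" using L t True hi_0 lo_1 by (auto simp: less_le)
  show ?thesis
  proof (cases "t = hi y")
    case False
    then have "hi y \<noteq> lo y" using L by auto
    then obtain i where "y = \<beta> i" using hi_eq_lo by blast
    have "t \<notin> gap i" using t(3) by (simp add: in_gap_def)
    then have "t = lo (\<beta> i) + g i * 0" using L False \<open>y = \<beta> i\<close> by auto
    then show ?thesis
      using flat_right_copy[OF copy_gap[of i], of 0] steep_right_copy[OF copy_gap[of i], of 0] flat_0 steep_0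
      by simp
  qed (use flat_hi steep_hi y in auto)
next
  case False
  define y where "y = L (1 - t)"
  have L: "0 \<le> y" "y \<le> 1" "lo y \<le> 1 - t" "1 - t \<le> hi y" using L_props[of "1 - t"] t False by (auto simp: y_def)
  have y: "0 < y" using L t hi_0 by (auto simp: less_le)
  show ?thesis
  proof (cases "1 - t = lo y")
    case True
    then have "t = 1 - lo y" by simp
    then show ?thesis using flat_lo steep_lo y L by auto
  next
    case False
    then have "hi y \<noteq> lo y" using L by auto
    then obtain i where "y = \<beta> i" using hi_eq_lo by blast
    have "1 - t \<notin> gap i" using t(3) by (simp add: in_gap_def)
    then have "1 - t = hi (\<beta> i)" using L False \<open>y = \<beta> i\<close> by auto
    then have "t = (1 - hi (\<beta> i)) + g i * 0" by simp
    then show ?thesis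
      using flat_right_copy[OF copy_gap_reflect[of i], of 0] steep_right_copy[OF copy_gap_reflect[of i], of 0] flat_0 steep_0
      by simp
  qed
qed

theorem T_rough:
  assumes "0 \<le> t" "t < 1"
  shows "flat_right T t" "steep_right T t"
proof -
  have "flat_right T t \<and> steep_right T t"
  proof (cases "t = 0")
    case False
    then have t: "0 < t" "t < 1" using assms by auto
    show ?thesis
    proof (cases "\<exists>p w q r x. copy p w q r \<and> 0 < x \<and> x < 1 \<and> t = p + w * x \<and> \<not> in_gap x")
      case True
      then obtain p w q r x where c: "copy p w q r" "0 < x" "x < 1" "t = p + w * x" "\<not> in_gap x" by blast
      then show ?thesis
        using flat_right_copy[OF c(1), of x] steep_right_copy[OF c(1), of x] regular_rough[of x] by auto
    next
      case False
      then show ?thesis using nested_copies[OF t] deep_flat[of t] deep_steep[of t] by blast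
    qed
  qed (use flat_0 steep_0 in auto)
  then show "flat_right T t" "steep_right T t" by auto
qed

end

section \<open>The distribution of values\<close>

lemma emeasure_lborel_affine:
  fixes c t :: real
  assumes "c \<noteq> 0" "S \<in> sets borel"
  shows "emeasure lborel S = ennreal \<bar>c\<bar> * emeasure lborel ((\<lambda>x. t + c * x) -` S)"
proof -
  have "emeasure lborel S = emeasure (density (distr lborel borel (\<lambda>x. t + c * x)) (\<lambda>_. ennreal \<bar>c\<bar>)) S"
    using lborel_real_affine[OF assms(1), of t] by simp
  also have "\<dots> = ennreal \<bar>c\<bar> * emeasure (distr lborel borel (\<lambda>x. t + c * x)) S"
    using assms(2) by (simp add: emeasure_density_const)
  also have "emeasure (distr lborel borel (\<lambda>x. t + c * x)) S = emeasure lborel ((\<lambda>x. t + c * x) -` S)"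
    using assms(2) by (simp add: emeasure_distr)
  finally show ?thesis .
qed

lemma measure_lborel_affine:
  fixes c t :: real
  assumes "c \<noteq> 0" "S \<in> sets borel"
  shows "measure lborel S = \<bar>c\<bar> * measure lborel ((\<lambda>x. t + c * x) -` S)"
  unfolding measure_def using emeasure_lborel_affine[OF assms, of t] by (simp add: enn2real_mult)

context gap_data
begin

text \<open>
  The time that \<open>T\<close> spends between the levels \<open>y\<close> and \<open>y'\<close>.
\<close>

definition occ :: "real \<Rightarrow> real \<Rightarrow> real" where
  "occ y y' = measure lborel {x \<in> unit_I. T x \<in> {y..y'}}"

lemma T_measurable [measurable]: "T \<in> borel_measurable borel"
  by (rule borel_measurable_continuous_onI[OF T_continuous])

lemma occ_nonneg: "0 \<le> occ y y'"
  unfolding occ_def by (rule measure_nonneg)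

lemma bounded_fmeasurable: "S \<in> sets borel \<Longrightarrow> S \<subseteq> unit_I \<Longrightarrow> S \<in> fmeasurable lborel"
  by (rule fmeasurableI2[of "{0..1}"]) (use fmeasurable_cbox[of "0 :: real" 1] in auto)

lemma measure_half:
  assumes [measurable]: "A \<in> sets borel"
  shows "measure lborel {x \<in> unit_I. T x \<in> A} = 2 * measure lborel {x \<in> {0..1/2}. T x \<in> A}"
proof -
  let ?S = "{x \<in> unit_I. T x \<in> A}" and ?L = "{x \<in> {0..1/2}. T x \<in> A}" and ?R = "{x \<in> {1/2<..1}. T x \<in> A}"
  have "?S = ?L \<union> ?R" by auto
  moreover have "?L \<in> fmeasurable lborel" "?R \<in> fmeasurable lborel"
    by (rule bounded_fmeasurable; auto)+
  ultimately have "measure lborel ?S = measure lborel ?L + measure lborel ?R"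
    using measure_Un_AE[of ?L ?R lborel, OF AE_I2] by (simp only:) auto
  moreover have "measure lborel ?R = measure lborel {x \<in> {0..<1/2}. T x \<in> A}"
  proof -
    have "(\<lambda>x. 1 + (- 1) * x) -` ?R = {x \<in> {0..<1/2}. T x \<in> A}" by (auto simp: T_reflect)
    then show ?thesis using measure_lborel_affine[of "-1" ?R 1] by simp
  qed
  moreover have "measure lborel {x \<in> {0..<1/2}. T x \<in> A} = measure lborel ?L"
  proof (rule measure_eq_AE)
    show "AE x in lborel. x \<in> {x \<in> {0..<1/2}. T x \<in> A} \<longleftrightarrow> x \<in> ?L"
      using AE_lborel_singleton[of "1/2 :: real"] by eventually_elim auto
  qed auto
  ultimately show ?thesis by simp
qed

lemma measure_gap:
  "measure lborel {u \<in> {lo (\<beta> i)..hi (\<beta> i)}. T u \<in> {y..y'}} = g i * occ ((\<beta> i - y') / h i) ((\<beta> i - y) / h i)"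
proof -
  let ?S = "{u \<in> {lo (\<beta> i)..hi (\<beta> i)}. T u \<in> {y..y'}}"
  have "(\<lambda>x. lo (\<beta> i) + g i * x) -` ?S = {x \<in> unit_I. T x \<in> {(\<beta> i - y') / h i..(\<beta> i - y) / h i}}"
  proof (rule set_eqI)
    fix x
    have "lo (\<beta> i) + g i * x \<in> {lo (\<beta> i)..hi (\<beta> i)} \<longleftrightarrow> x \<in> unit_I"
      using g_pos[of i] hi_level[of i] by (auto simp: zero_le_mult_iff)
    then show "x \<in> (\<lambda>x. lo (\<beta> i) + g i * x) -` ?S \<longleftrightarrow> x \<in> {x \<in> unit_I. T x \<in> {(\<beta> i - y') / h i..(\<beta> i - y) / h i}}"
      using T_copy[of x i] height_pos[of i] by (auto simp: field_simps)
  qed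
  moreover have "?S \<in> sets borel" by measurable
  ultimately show ?thesis
    using measure_lborel_affine[of "g i" ?S "lo (\<beta> i)"] g_pos[of i] by (simp add: occ_def)
qed

text \<open>
  The part of the left half, outside the open gaps, where the staircase runs through the levels from
  \<open>z\<close> to \<open>z'\<close>.
\<close>

definition core :: "real \<Rightarrow> real \<Rightarrow> real set" where
  "core z z' = {lo z..hi z'} - (\<Union>i\<in>{i. \<beta> i \<in> {z..z'}}. gap i)"

lemma core_borel [measurable]: "core z z' \<in> sets borel"
  unfolding core_def by measurable

lemma L_between:
  assumes "0 \<le> z" "z \<le> z'" "z' \<le> 1" "0 \<le> u" "u \<le> 1 / 2"
  shows "L u \<in> {z..z'} \<longleftrightarrow> u \<in> {lo z..hi z'}"
proof
  note L = L_props[OF assms(4,5)]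
  assume "L u \<in> {z..z'}"
  then show "u \<in> {lo z..hi z'}"
    using lo_mono[of z "L u"] hi_mono[of "L u" z'] L assms by auto
next
  note L = L_props[OF assms(4,5)]
  assume u: "u \<in> {lo z..hi z'}"
  then show "L u \<in> {z..z'}"
    using hi_less_lo[of "L u" z] hi_less_lo[of z' "L u"] L assms by (auto simp: not_less[symmetric])
qed

lemma core_subset: 
  assumes "0 \<le> z" "z \<le> z'" "z' \<le> 1" "u \<in> core z z'"
  shows "0 \<le> u" "u \<le> 1 / 2" "T u \<in> {z..z'}"
proof -
  show u: "0 \<le> u" "u \<le> 1 / 2"
    using assms lo_nonneg[of z] hi_le_half[of z'] by (auto simp: core_def)
  have L: "L u \<in> {z..z'}" using L_between[of z z' u] assms u by (auto simp: core_def)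
  have "u \<notin> gap i" for i using L_gap[of i u] L assms(4) by (auto simp: core_def)
  then show "T u \<in> {z..z'}" using T_regular[of u] u L by simp
qed

text \<open>
  The interval \<open>{lo z..hi z'}\<close> has length \<open>\<kappa> * (z'\<^sup>2 - z\<^sup>2) + weight g {z..z'}\<close>, and the second
  summand is the total length of the gaps that are removed from it.
\<close>

lemma measure_core:
  assumes "0 \<le> z" "z \<le> z'" "z' \<le> 1"
  shows "measure lborel (core z z') = \<kappa> * (z'\<^sup>2 - z\<^sup>2)"
proof -
  let ?G = "\<lambda>i. if \<beta> i \<in> {z..z'} then gap i else {}"
  have U: "(\<Union>i\<in>{i. \<beta> i \<in> {z..z'}}. gap i) = (\<Union>i. ?G i)" by (auto split: if_splits)
  have sub: "(\<Union>i. ?G i) \<subseteq> {lo z..hi z'}"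
  proof (rule UN_least)
    fix i
    have "lo z \<le> lo (\<beta> i) \<and> hi (\<beta> i) \<le> hi z'" if "\<beta> i \<in> {z..z'}"
      using that assms level_pos[of i] lo_mono[of z "\<beta> i"] hi_mono[of "\<beta> i" z'] by auto
    then show "?G i \<subseteq> {lo z..hi z'}" by (auto split: if_splits)
  qed
  have disj: "disjoint_family ?G"
    unfolding disjoint_family_on_def
  proof (intro ballI impI)
    fix i j :: nat assume "i \<noteq> j"
    then have "gap i \<inter> gap j = {}" using gap_unique by blast
    then show "?G i \<inter> ?G j = {}" by auto
  qed
  have lh: "lo z \<le> hi z'" using lo_le_hi[of z] hi_mono[of z z'] assms by linarith
  have "emeasure lborel (\<Union>i. ?G i) = (\<Sum>i. emeasure lborel (?G i))"
    by (rule suminf_emeasure[symmetric]) (use disj in auto)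
  also have "\<dots> = (\<Sum>i. ennreal (g i * indicator {z..z'} (\<beta> i)))"
    using hi_level lo_less_hi_level by (intro suminf_cong) (auto simp: less_imp_le)
  also have "\<dots> = ennreal (weight g {z..z'})"
    unfolding weight_def by (intro suminf_ennreal2 weight_summable_g) (auto simp: less_imp_le g_pos)
  finally have m: "measure lborel (\<Union>i. ?G i) = weight g {z..z'}"
    by (simp add: measure_def weight_nonneg)
  have "measure lborel ({lo z..hi z'} - (\<Union>i. ?G i)) = measure lborel {lo z..hi z'} - measure lborel (\<Union>i. ?G i)"
    using sub lh by (intro measure_Diff) auto
  then show ?thesis unfolding core_def U m using lh hi_minus_lo[OF assms(2)] by simp
qed

lemma occ_ge_twice_half:
  assumes "S \<subseteq> {x \<in> {0..1/2}. T x \<in> {y..y'}}" "S \<in> sets borel"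
  shows "2 * measure lborel S \<le> occ y y'"
proof -
  have "measure lborel S \<le> measure lborel {x \<in> {0..1/2}. T x \<in> {y..y'}}"
    by (intro measure_mono_fmeasurable bounded_fmeasurable assms) (use assms in auto)
  then show ?thesis using measure_half[of "{y..y'}"] by (simp add: occ_def)
qed

text \<open>
  Each half of the unit interval splits into the staircase outside the gaps, which spends at most
  \<open>y' - y\<close> between the two levels, and the gaps, where self-similarity allows the claim for \<open>n\<close> to be
  used on levels stretched by \<open>1 / h i\<close>. As \<open>\<Sum>i. g i / h i = \<Sum>i. \<rho> i \<le> 1 / 4\<close>, this reproduces the
  Lipschitz constant \<open>4\<close> and halves the error term.
\<close>

lemma occ_upper_iterate:
  assumes "y \<le> y'"
  shows "occ y y' \<le> 4 * (y' - y) + (1 / 2) ^ n"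
  using assms
proof (induction n arbitrary: y y')
  case 0
  have "occ y y' \<le> measure lborel unit_I"
    unfolding occ_def by (intro measure_mono_fmeasurable bounded_fmeasurable) auto
  then show ?case using 0 by simp
next
  case (Suc n)
  let ?e = "(1 / 2) ^ n :: real"
  let ?S = "{u \<in> {0..1/2}. T u \<in> {y..y'}}"
  let ?G = "\<lambda>i. {u \<in> {lo (\<beta> i)..hi (\<beta> i)}. T u \<in> {y..y'}}"
  define R where "R = (if max y 0 \<le> min y' 1 then core (max y 0) (min y' 1) else {})"
  have R [measurable]: "R \<in> sets borel" by (simp add: R_def)
  have "?S \<subseteq> R \<union> (\<Union>i. ?G i)"
  proof
    fix u assume u: "u \<in> ?S"
    show "u \<in> R \<union> (\<Union>i. ?G i)"
    proof (cases "\<exists>i. u \<in> gap i")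
      case True
      then obtain i where "u \<in> gap i" by blast
      then have "u \<in> ?G i" using u by auto
      then show ?thesis by blast
    next
      case False
      then have T: "T u = L u" using T_regular[of u] u by auto
      have "L u \<in> {max y 0..min y' 1}" using u T L_props[of u] by auto
      moreover from this have le: "max y 0 \<le> min y' 1" by (meson atLeastAtMost_iff order_trans)
      ultimately have "u \<in> {lo (max y 0)..hi (min y' 1)}"
        using L_between[of "max y 0" "min y' 1" u] u by auto
      then have "u \<in> R" using le False by (auto simp: R_def core_def)
      then show ?thesis by simp
    qed
  qed
  then have "emeasure lborel ?S \<le> emeasure lborel (R \<union> (\<Union>i. ?G i))" by (intro emeasure_mono) auto
  also have "\<dots> \<le> emeasure lborel R + emeasure lborel (\<Union>i. ?G i)" by (intro emeasure_subadditive) auto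
  also have "emeasure lborel R \<le> ennreal (y' - y)"
  proof (cases "max y 0 \<le> min y' 1")
    case True
    have "u \<in> unit_I" if "u \<in> core (max y 0) (min y' 1)" for u
      using core_subset(1,2)[OF _ True _ that] by simp
    then have "core (max y 0) (min y' 1) \<in> fmeasurable lborel"
      by (intro bounded_fmeasurable subsetI core_borel)
    then have "emeasure lborel R = ennreal (measure lborel (core (max y 0) (min y' 1)))"
      using True by (simp add: R_def emeasure_eq_measure2)
    also have "measure lborel (core (max y 0) (min y' 1)) \<le> y' - y"
    proof -
      have "min y' 1 - max y 0 \<le> y' - y" by simp
      then show ?thesis
        using measure_core[OF _ True] kappa_squares_le[OF _ True] by simp
    qed
    finally show ?thesis by (simp add: ennreal_leI)
  next
    case False
    then have "R = {}" unfolding R_def by (rule if_not_P)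
    then show ?thesis by simp
  qed
  also have "emeasure lborel (\<Union>i. ?G i) \<le> (\<Sum>i. emeasure lborel (?G i))"
    by (intro emeasure_subadditive_countably) auto
  also have "(\<Sum>i. emeasure lborel (?G i)) \<le> (\<Sum>i. ennreal (\<rho> i * (4 * (y' - y) + ?e)))"
  proof (intro suminf_le summableI)
    fix i
    have "?G i \<in> fmeasurable lborel"
      using lo_nonneg[of "\<beta> i"] hi_le_half[of "\<beta> i"] level_pos[of i] level_less[of i]
      by (intro bounded_fmeasurable) auto
    then have "emeasure lborel (?G i) = ennreal (g i * occ ((\<beta> i - y') / h i) ((\<beta> i - y) / h i))"
      using measure_gap[of i y y'] by (simp add: emeasure_eq_measure2)
    also have "g i * occ ((\<beta> i - y') / h i) ((\<beta> i - y) / h i)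
        \<le> g i * (4 * ((\<beta> i - y) / h i - (\<beta> i - y') / h i) + ?e)"
      using Suc.prems g_pos[of i] height_pos[of i]
      by (intro mult_left_mono Suc.IH divide_right_mono) auto
    also have "\<dots> = \<rho> i * (4 * (y' - y)) + g i * ?e"
      using height_pos[of i] by (simp add: g_def field_simps)
    also have "\<dots> \<le> \<rho> i * (4 * (y' - y)) + \<rho> i * ?e"
      using g_le[of i] by simp
    finally show "emeasure lborel (?G i) \<le> ennreal (\<rho> i * (4 * (y' - y) + ?e))"
      by (simp add: ennreal_leI distrib_left)
  qed
  also have "(\<Sum>i. ennreal (\<rho> i * (4 * (y' - y) + ?e))) = ennreal (suminf \<rho> * (4 * (y' - y) + ?e))"
    using Suc.prems ratio_pos
    by (subst suminf_ennreal2) (auto simp: less_imp_le suminf_mult2[symmetric] ratio_summable intro!: summable_mult2)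
  also have "suminf \<rho> * (4 * (y' - y) + ?e) \<le> 1 / 4 * (4 * (y' - y) + ?e)"
    using Suc.prems ratio_suminf by (intro mult_right_mono) auto
  finally have bound: "emeasure lborel ?S \<le> ennreal (y' - y) + ennreal (1 / 4 * (4 * (y' - y) + ?e))"
    by (simp add: add_left_mono ennreal_leI)
  have "emeasure lborel ?S \<le> ennreal (2 * (y' - y) + ?e / 4)"
  proof -
    have "ennreal (y' - y) + ennreal (1 / 4 * (4 * (y' - y) + ?e)) = ennreal ((y' - y) + 1 / 4 * (4 * (y' - y) + ?e))"
      using Suc.prems by (intro ennreal_plus[symmetric] mult_nonneg_nonneg add_nonneg_nonneg) auto
    moreover have "(y' - y) + 1 / 4 * (4 * (y' - y) + ?e) = 2 * (y' - y) + ?e / 4"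
      by (simp add: distrib_left diff_divide_distrib)
    ultimately show ?thesis using bound by (simp only:)
  qed
  then have "measure lborel ?S \<le> 2 * (y' - y) + ?e / 4"
    using Suc.prems unfolding measure_def by (intro enn2real_leI add_nonneg_nonneg) auto
  then show ?case using measure_half[of "{y..y'}"] by (simp add: occ_def)
qed

lemma occ_upper: "y \<le> y' \<Longrightarrow> occ y y' \<le> 4 * (y' - y)"
proof (rule field_le_epsilon)
  fix e :: real assume "y \<le> y'" "0 < e"
  then obtain n where "(1 / 2) ^ n < e" using real_arch_pow_inv[of e "1 / 2"] by auto
  then show "occ y y' \<le> 4 * (y' - y) + e" using occ_upper_iterate[OF \<open>y \<le> y'\<close>, of n] by linarith
qed

lemma occ_lower_high:
  assumes "1 / 4 \<le> y" "y \<le> y'" "y' \<le> 1"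
  shows "(y' - y) / 8 \<le> occ y y'"
proof -
  have "1 / 4 / 4 * (y' - y) \<le> y' / 4 * (y' - y)" using assms by (intro mult_right_mono) auto
  also have "\<dots> \<le> measure lborel (core y y')"
    using measure_core[of y y'] kappa_squares_ge[of y y'] assms by simp
  finally have "(y' - y) / 16 \<le> measure lborel (core y y')" by simp
  moreover have "2 * measure lborel (core y y') \<le> occ y y'"
    using core_subset[of y y'] assms by (intro occ_ge_twice_half) auto
  ultimately show ?thesis by simp
qed

text \<open>
  The staircase has vanishing density at level \<open>0\<close>. But the copy hanging from level \<open>1 / 2\<close> has height
  \<open>1 / 2\<close>, so it maps the levels in \<open>{1 / 2..1}\<close>, where the density is known to be positive, onto
  those in \<open>{0..1 / 4}\<close>.
\<close>

lemma occ_lower_low: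
  assumes "0 \<le> y" "y \<le> y'" "y' \<le> 1 / 4"
  shows "g 0 / 4 * (y' - y) \<le> occ y y'"
proof -
  let ?S = "{u \<in> {lo (\<beta> 0)..hi (\<beta> 0)}. T u \<in> {y..y'}}"
  have "(1 - 2 * y - (1 - 2 * y')) / 8 \<le> occ (1 - 2 * y') (1 - 2 * y)"
    using assms by (intro occ_lower_high) auto
  then have "g 0 * ((y' - y) / 4) \<le> g 0 * occ (1 - 2 * y') (1 - 2 * y)"
    using g_pos[of 0] by (intro mult_left_mono) auto
  also have "\<dots> = measure lborel ?S" 
    using measure_gap[of 0 y y'] by (simp add: half_gap diff_divide_distrib mult.commute)
  also have "\<dots> \<le> 2 * measure lborel ?S" by simp
  also have "\<dots> \<le> occ y y'"
    using lo_nonneg[of "\<beta> 0"] hi_le_half[of "\<beta> 0"] level_pos[of 0] level_less[of 0]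
    by (intro occ_ge_twice_half) auto
  finally show ?thesis by simp
qed

definition P :: "real \<Rightarrow> real" where
  "P y = measure lborel {x \<in> unit_I. T x \<le> y}"

lemma P_diff:
  assumes "y \<le> y'"
  shows "P y' - P y = occ y y'"
proof -
  let ?A = "{x \<in> unit_I. T x \<le> y}" and ?B = "{x \<in> unit_I. T x \<in> {y<..y'}}" and ?C = "{x \<in> unit_I. T x \<in> {y..y}}"
  have fin: "?A \<in> fmeasurable lborel" "?B \<in> fmeasurable lborel" "?C \<in> fmeasurable lborel"
    by (rule bounded_fmeasurable; auto)+
  have "{x \<in> unit_I. T x \<le> y'} = ?A \<union> ?B" using assms by auto
  moreover have "measure lborel (?A \<union> ?B) = measure lborel ?A + measure lborel ?B"
    using fin by (intro measure_Un_AE AE_I2) auto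
  moreover have "{x \<in> unit_I. T x \<in> {y..y'}} = ?C \<union> ?B" using assms by auto
  moreover have "measure lborel (?C \<union> ?B) = measure lborel ?C + measure lborel ?B"
    using fin by (intro measure_Un_AE AE_I2) auto
  moreover have "measure lborel ?C = 0"
  proof -
    have "measure lborel ?C \<le> 0" using occ_upper[of y y] by (simp only: occ_def) simp
    then show ?thesis by (simp only: measure_le_0_iff)
  qed
  ultimately show ?thesis by (simp add: P_def occ_def)
qed

lemma P_0: "P 0 = 0"
proof -
  have "{x \<in> unit_I. T x \<le> 0} = {x \<in> unit_I. T x \<in> {0..0}}" using T_bounds(1) by (auto intro: antisym)
  then have "P 0 = occ 0 0" by (simp add: P_def occ_def)
  then show ?thesis using occ_upper[of 0 0] by (simp add: occ_def antisym)
qed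

lemma P_1: "P 1 = 1"
proof -
  have "{x \<in> unit_I. T x \<le> 1} = unit_I" using T_bounds by auto
  then show ?thesis by (simp add: P_def)
qed

lemma P_lower:
  assumes "0 \<le> y" "y \<le> y'" "y' \<le> 1"
  shows "g 0 / 4 * (y' - y) \<le> P y' - P y"
proof -
  have g0: "g 0 / 4 \<le> 1 / 8" using g_le_height[of 0] half_gap by simp
  have high: "g 0 / 4 * (b - a) \<le> P b - P a" if "1 / 4 \<le> a" "a \<le> b" "b \<le> 1" for a b
  proof -
    have "g 0 / 4 * (b - a) \<le> 1 / 8 * (b - a)" using g0 that by (intro mult_right_mono) auto
    then show ?thesis using occ_lower_high[OF that] P_diff[OF that(2)] by linarith
  qed
  have low: "g 0 / 4 * (b - a) \<le> P b - P a" if "0 \<le> a" "a \<le> b" "b \<le> 1 / 4" for a b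
    using occ_lower_low[OF that] P_diff[OF that(2)] by simp
  show "g 0 / 4 * (y' - y) \<le> P y' - P y"
  proof (cases "y' \<le> 1 / 4 \<or> 1 / 4 \<le> y")
    case True then show ?thesis using low high assms by blast
  next
    case False
    then have "g 0 / 4 * (1 / 4 - y) + g 0 / 4 * (y' - 1 / 4) \<le> P y' - P y"
      using low[of y "1 / 4"] high[of "1 / 4" y'] assms by linarith
    moreover have "g 0 / 4 * (1 / 4 - y) + g 0 / 4 * (y' - 1 / 4) = g 0 / 4 * (y' - y)"
      by (simp flip: distrib_left)
    ultimately show ?thesis by simp
  qed
qed

lemma P_lipschitz: "\<bar>P y' - P y\<bar> \<le> 4 * \<bar>y' - y\<bar>"
proof (cases "y \<le> y'")
  case True
  then show ?thesis using P_diff[OF True] occ_upper[OF True] occ_nonneg[of y y'] by simp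
next
  case False
  then have "y' \<le> y" by simp
  then show ?thesis
    using P_diff[OF \<open>y' \<le> y\<close>] occ_upper[OF \<open>y' \<le> y\<close>] occ_nonneg[of y' y]
    by (simp add: abs_minus_commute[of "P y'"] abs_minus_commute[of y'])
qed

lemma P_continuous: "continuous_on A P"
proof (rule continuous_on_subset[OF _ subset_UNIV])
  show "continuous_on UNIV P"
    unfolding continuous_on_iff
  proof (intro ballI allI impI)
    fix y e :: real assume "0 < e"
    moreover have "dist (P x) (P y) < e" if "dist x y < e / 4" for x
      using P_lipschitz[of x y] that unfolding dist_real_def by simp
    ultimately show "\<exists>d>0. \<forall>x\<in>UNIV. dist x y < d \<longrightarrow> dist (P x) (P y) < e"
      by (intro exI[of _ "e / 4"]) simp
  qed
qed

lemma P_mono: "y \<le> y' \<Longrightarrow> P y \<le> P y'"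
  using P_diff[of y y'] occ_nonneg[of y y'] by simp

lemma P_less:
  assumes "0 \<le> y" "y < y'" "y' \<le> 1"
  shows "P y < P y'"
proof -
  have "0 < g 0 / 4 * (y' - y)" using g_pos[of 0] assms by simp
  then show ?thesis using P_lower[of y y'] assms by simp
qed

section \<open>The measure-preserving function\<close>

definition f :: "real \<Rightarrow> real" where "f x = P (T x)"

lemma f_continuous: "continuous_on A f"
  unfolding f_def using continuous_on_compose2[OF P_continuous[of UNIV] T_continuous[of A]] by simp

lemma f_measurable [measurable]: "f \<in> borel_measurable borel"
  by (rule borel_measurable_continuous_onI[OF f_continuous])

lemma f_reflect: "f (1 - x) = f x"
  by (simp add: f_def T_reflect)

lemma f_bounds: "0 \<le> f x" "f x \<le> 1"
  using P_mono[of 0 "T x"] P_mono[of "T x" 1] T_bounds[of x] P_0 P_1 by (auto simp: f_def)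

lemma f_onto: "f ` unit_I = unit_I"
proof
  show "f ` unit_I \<subseteq> unit_I" using f_bounds by auto
  show "unit_I \<subseteq> f ` unit_I"
  proof
    fix z :: real assume "z \<in> unit_I"
    then have "\<exists>x\<ge>0. x \<le> 1 / 2 \<and> f x = z"
      by (intro IVT') (auto simp: f_def T_0 T_half P_0 P_1 f_continuous[unfolded f_def])
    then show "z \<in> f ` unit_I" by force
  qed
qed

lemma f_superlevel:
  assumes "0 \<le> z" "z < 1"
  shows "emeasure lborel {x \<in> unit_I. z < f x} = ennreal (1 - z)"
proof -
  have "\<exists>y\<ge>0. y \<le> 1 \<and> P y = z"
    using assms by (intro IVT') (auto simp: P_0 P_1 P_continuous)
  then obtain y where y: "0 \<le> y" "y \<le> 1" "P y = z" by auto
  have "z < f x \<longleftrightarrow> \<not> T x \<le> y" for x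
    using P_mono[of "T x" y] P_less[of y "T x"] T_bounds[of x] y by (auto simp: f_def)
  then have "{x \<in> unit_I. z < f x} = unit_I - {x \<in> unit_I. T x \<le> y}" by blast
  moreover have "measure lborel (unit_I - {x \<in> unit_I. T x \<le> y}) = 1 - z"
  proof -
    have "measure lborel (unit_I - {x \<in> unit_I. T x \<le> y}) = measure lborel unit_I - P y"
      unfolding P_def by (rule measure_Diff) auto
    then show ?thesis using y(3) by simp
  qed
  moreover have "{x \<in> unit_I. z < f x} \<in> fmeasurable lborel"
    by (rule bounded_fmeasurable) auto
  ultimately show ?thesis by (simp add: emeasure_eq_measure2)
qed

lemma f_in_C_lambda: "f \<in> C_lambda"
proof -
  let ?I = "restrict_space lborel unit_I"
  have [measurable]: "f \<in> ?I \<rightarrow>\<^sub>M borel" "(\<lambda>x. x) \<in> ?I \<rightarrow>\<^sub>M borel"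
    by (rule measurable_restrict_space1, simp)+
  have em: "emeasure (distr ?I borel k) A = emeasure lborel (k -` A \<inter> unit_I)"
    if "k \<in> ?I \<rightarrow>\<^sub>M borel" "A \<in> sets borel" for k :: "real \<Rightarrow> real" and A
    using that by (simp add: emeasure_distr space_restrict_space emeasure_restrict_space)
  have "distr ?I borel (\<lambda>x. x) = distr ?I borel f"
  proof (rule measure_eqI_lessThan)
    fix z :: real
    have "emeasure lborel ((\<lambda>x. x) -` {z<..} \<inter> unit_I) \<le> emeasure lborel unit_I"
      by (intro emeasure_mono) auto
    then show "emeasure (distr ?I borel (\<lambda>x. x)) {z<..} < \<infinity>"
      by (auto simp: em intro: le_less_trans)
    have f_eq: "f -` {z<..} \<inter> unit_I = {x \<in> unit_I. z < f x}" by auto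
    consider "z < 0" | "0 \<le> z" "z < 1" | "1 \<le> z" by linarith
    then have "emeasure lborel ((\<lambda>x. x) -` {z<..} \<inter> unit_I) = emeasure lborel (f -` {z<..} \<inter> unit_I)"
    proof cases
      case 1
      then have "(\<lambda>x. x) -` {z<..} \<inter> unit_I = unit_I" "f -` {z<..} \<inter> unit_I = unit_I"
        using f_bounds(1) by (auto intro: less_le_trans)
      then show ?thesis by simp
    next
      case 2
      have "(\<lambda>x. x) -` {z<..} \<inter> unit_I = {z<..1}" using 2 by auto
      then show ?thesis using 2 f_superlevel[of z] f_eq by simp
    next
      case 3
      have "\<not> z < f x" for x using f_bounds(2)[of x] 3 by simp
      then have "(\<lambda>x. x) -` {z<..} \<inter> unit_I = {}" "f -` {z<..} \<inter> unit_I = {}"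
        using 3 by auto
      then show ?thesis by simp
    qed
    then show "emeasure (distr ?I borel (\<lambda>x. x)) {z<..} = emeasure (distr ?I borel f) {z<..}"
      by (simp add: em)
  qed simp_all
  then have "emeasure lborel A = emeasure lborel (f -` A \<inter> unit_I)" if "A \<in> sets borel" "A \<subseteq> unit_I" for A
    using em[of "\<lambda>x. x" A] em[of f A] that by (simp add: Int_absorb2)
  then show ?thesis unfolding C_lambda_def using f_continuous f_onto by blast
qed

lemma f_rough:
  assumes "0 \<le> t" "t < 1"
  shows "flat_right f t" "steep_right f t"
proof -
  obtain C where C: "\<And>\<delta>. \<delta> > 0 \<Longrightarrow> \<exists>x\<in>unit_I. t < x \<and> x < t + \<delta> \<and> \<bar>T x - T t\<bar> \<le> C * (x - t)"
    using T_rough(1)[OF assms] by (auto simp: flat_right_def)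
  show "flat_right f t"
    unfolding flat_right_def
  proof (intro exI[of _ "4 * C"] allI impI)
    fix \<delta> :: real assume "0 < \<delta>"
    then obtain x where "x \<in> unit_I" "t < x" "x < t + \<delta>" "\<bar>T x - T t\<bar> \<le> C * (x - t)" using C by blast
    then show "\<exists>x\<in>unit_I. t < x \<and> x < t + \<delta> \<and> \<bar>f x - f t\<bar> \<le> 4 * C * (x - t)"
      using P_lipschitz[of "T x" "T t"] by (intro bexI[of _ x]) (auto simp: f_def)
  qed
  define c where "c = g 0 / 4"
  have c: "0 < c" using g_pos by (simp add: c_def)
  have P: "c * \<bar>T x - T t\<bar> \<le> \<bar>f x - f t\<bar>" for x
    using P_lower[of "T x" "T t"] P_lower[of "T t" "T x"] T_bounds[of x] T_bounds[of t]
    by (cases "T x \<le> T t") (auto simp: f_def c_def abs_if)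
  show "steep_right f t"
    unfolding steep_right_def
  proof (intro allI impI)
    fix N \<delta> :: real assume "0 < \<delta>"
    then obtain x where x: "x \<in> unit_I" "t < x" "x < t + \<delta>" "N / c * (x - t) \<le> \<bar>T x - T t\<bar>"
      using T_rough(2)[OF assms] unfolding steep_right_def by blast
    have "N * (x - t) = c * (N / c * (x - t))" using c by simp
    also have "\<dots> \<le> c * \<bar>T x - T t\<bar>" using x c by (intro mult_left_mono) auto
    finally show "\<exists>x\<in>unit_I. t < x \<and> x < t + \<delta> \<and> N * (x - t) \<le> \<bar>f x - f t\<bar>"
      using P[of x] x by (intro bexI[of _ x]) auto
  qed
qed

end

section \<open>Dini derivatives\<close>

text \<open>
  Bounds on both Dini derivatives would bound the quotients; and if both were equal to the same
  infinite value, the quotients would tend to infinity in absolute value.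
\<close>

lemma limits_of_rough_quotient:
  fixes q :: "'a \<Rightarrow> real"
  assumes flat: "\<exists>\<^sub>F x in K. \<bar>q x\<bar> \<le> C" and steep: "\<And>N. \<exists>\<^sub>F x in K. N \<le> \<bar>q x\<bar>"
  shows "max \<bar>Limsup K (\<lambda>x. ereal (q x))\<bar> \<bar>Liminf K (\<lambda>x. ereal (q x))\<bar> = \<infinity>" (is "?M = \<infinity>")
    and "Limsup K (\<lambda>x. ereal (q x)) \<noteq> Liminf K (\<lambda>x. ereal (q x))" (is "?S \<noteq> ?I")
proof -
  show inf: "?M = \<infinity>"
  proof (rule ccontr)
    assume "?M \<noteq> \<infinity>"
    then have "\<bar>?S\<bar> \<noteq> \<infinity>" "\<bar>?I\<bar> \<noteq> \<infinity>" by (auto simp: max_def split: if_splits)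
    then obtain s i where si: "?S = ereal s" "?I = ereal i" by auto
    then have "\<forall>\<^sub>F x in K. ereal (q x) < ereal (s + 1)" "\<forall>\<^sub>F x in K. ereal (i - 1) < ereal (q x)"
      using Limsup_lessD[of K "\<lambda>x. ereal (q x)" "ereal (s + 1)"]
        less_LiminfD[of "ereal (i - 1)" K "\<lambda>x. ereal (q x)"] by simp_all
    then have "\<forall>\<^sub>F x in K. \<not> \<bar>s\<bar> + \<bar>i\<bar> + 1 \<le> \<bar>q x\<bar>"
      by eventually_elim auto
    then show False using steep[of "\<bar>s\<bar> + \<bar>i\<bar> + 1"] by (simp add: frequently_def)
  qed
  show "?S \<noteq> ?I"
  proof
    assume eq: "?S = ?I"
    then consider "?I = \<infinity>" | "?S = - \<infinity>" using inf by (cases ?I) auto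
    then have "\<forall>\<^sub>F x in K. \<not> \<bar>q x\<bar> \<le> C"
    proof cases
      case 1
      then have "\<forall>\<^sub>F x in K. ereal C < ereal (q x)" by (intro less_LiminfD) auto
      then show ?thesis by eventually_elim auto
    next
      case 2
      then have "\<forall>\<^sub>F x in K. ereal (q x) < ereal (- C)" by (intro Limsup_lessD) auto
      then show ?thesis by eventually_elim auto
    qed
    then show False using flat by (simp add: frequently_def)
  qed
qed

lemma frequently_at_right_I:
  assumes "\<And>\<delta>. 0 < \<delta> \<Longrightarrow> \<exists>x\<in>unit_I. t < x \<and> x < t + \<delta> \<and> Q x"
  shows "\<exists>\<^sub>F x in at t within (unit_I \<inter> {t<..}). Q x"
  unfolding frequently_def eventually_at
proof
  assume "\<exists>d>0. \<forall>x\<in>unit_I \<inter> {t<..}. x \<noteq> t \<and> dist x t < d \<longrightarrow> \<not> Q x"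
  then obtain d where "d > 0" "\<And>x. x \<in> unit_I \<Longrightarrow> t < x \<Longrightarrow> dist x t < d \<Longrightarrow> \<not> Q x" by auto
  then show False using assms[of d] by (force simp: dist_real_def)
qed

lemma frequently_at_left_I:
  assumes "\<And>\<delta>. 0 < \<delta> \<Longrightarrow> \<exists>x\<in>unit_I. 1 - t < x \<and> x < 1 - t + \<delta> \<and> Q (1 - x)"
  shows "\<exists>\<^sub>F x in at t within (unit_I \<inter> {..<t}). Q x"
  unfolding frequently_def eventually_at
proof
  assume "\<exists>d>0. \<forall>x\<in>unit_I \<inter> {..<t}. x \<noteq> t \<and> dist x t < d \<longrightarrow> \<not> Q x"
  then obtain d where d: "d > 0" "\<And>x. x \<in> unit_I \<Longrightarrow> x < t \<Longrightarrow> dist x t < d \<Longrightarrow> \<not> Q x" by auto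
  obtain x where "x \<in> unit_I" "1 - t < x" "x < 1 - t + d" "Q (1 - x)" using assms[OF d(1)] by blast
  then show False using d(2)[of "1 - x"] by (auto simp: dist_real_def)
qed

lemma rough_right:
  assumes "flat_right F t" "steep_right F t"
  shows "max \<bar>dini_upper_right F t\<bar> \<bar>dini_lower_right F t\<bar> = \<infinity>" "\<not> right_derivative_exists F t"
proof -
  let ?q = "\<lambda>x. (F x - F t) / (x - t)"
  obtain C where C: "\<And>\<delta>. \<delta> > 0 \<Longrightarrow> \<exists>x\<in>unit_I. t < x \<and> x < t + \<delta> \<and> \<bar>F x - F t\<bar> \<le> C * (x - t)"
    using assms(1) by (auto simp: flat_right_def)
  have flat: "\<exists>\<^sub>F x in at t within (unit_I \<inter> {t<..}). \<bar>?q x\<bar> \<le> C"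
  proof (rule frequently_at_right_I)
    fix \<delta> :: real assume "0 < \<delta>"
    then show "\<exists>x\<in>unit_I. t < x \<and> x < t + \<delta> \<and> \<bar>?q x\<bar> \<le> C"
      using C[of \<delta>] by (force simp: abs_divide divide_le_eq)
  qed
  have steep: "\<exists>\<^sub>F x in at t within (unit_I \<inter> {t<..}). N \<le> \<bar>?q x\<bar>" for N
  proof (rule frequently_at_right_I)
    fix \<delta> :: real assume "0 < \<delta>"
    then obtain x where "x \<in> unit_I" "t < x" "x < t + \<delta>" "N * (x - t) \<le> \<bar>F x - F t\<bar>"
      using assms(2) unfolding steep_right_def by blast
    then show "\<exists>x\<in>unit_I. t < x \<and> x < t + \<delta> \<and> N \<le> \<bar>?q x\<bar>"
      by (intro bexI[of _ x]) (auto simp: abs_divide le_divide_eq)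
  qed
  show "max \<bar>dini_upper_right F t\<bar> \<bar>dini_lower_right F t\<bar> = \<infinity>" "\<not> right_derivative_exists F t"
    using limits_of_rough_quotient[OF flat steep]
    by (auto simp: dini_upper_right_def dini_lower_right_def right_derivative_exists_def diff_quot_def[abs_def])
qed

lemma rough_left:
  assumes "flat_right F (1 - t)" "steep_right F (1 - t)" "\<And>x. F (1 - x) = F x"
  shows "max \<bar>dini_upper_left F t\<bar> \<bar>dini_lower_left F t\<bar> = \<infinity>" "\<not> left_derivative_exists F t"
proof -
  let ?q = "\<lambda>x. (F x - F t) / (x - t)"
  have q: "\<bar>?q (1 - x)\<bar> = \<bar>F x - F (1 - t)\<bar> / (x - (1 - t))" if "1 - t < x" for x
    using that assms(3) by (simp add: abs_divide)
  obtain C where C: "\<And>\<delta>. \<delta> > 0 \<Longrightarrow> \<exists>x\<in>unit_I. 1 - t < x \<and> x < 1 - t + \<delta> \<and> \<bar>F x - F (1 - t)\<bar> \<le> C * (x - (1 - t))"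
    using assms(1) by (auto simp: flat_right_def)
  have flat: "\<exists>\<^sub>F x in at t within (unit_I \<inter> {..<t}). \<bar>?q x\<bar> \<le> C"
  proof (rule frequently_at_left_I)
    fix \<delta> :: real assume "0 < \<delta>"
    then obtain x where x: "x \<in> unit_I" "1 - t < x" "x < 1 - t + \<delta>" "\<bar>F x - F (1 - t)\<bar> \<le> C * (x - (1 - t))"
      using C by blast
    have "\<bar>?q (1 - x)\<bar> \<le> C" unfolding q[OF x(2)] using x by (simp add: divide_le_eq)
    then show "\<exists>x\<in>unit_I. 1 - t < x \<and> x < 1 - t + \<delta> \<and> \<bar>?q (1 - x)\<bar> \<le> C" using x by blast
  qed
  have steep: "\<exists>\<^sub>F x in at t within (unit_I \<inter> {..<t}). N \<le> \<bar>?q x\<bar>" for N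
  proof (rule frequently_at_left_I)
    fix \<delta> :: real assume "0 < \<delta>"
    then obtain x where x: "x \<in> unit_I" "1 - t < x" "x < 1 - t + \<delta>" "N * (x - (1 - t)) \<le> \<bar>F x - F (1 - t)\<bar>"
      using assms(2) unfolding steep_right_def by blast
    have "N \<le> \<bar>?q (1 - x)\<bar>" unfolding q[OF x(2)] using x by (simp add: le_divide_eq)
    then show "\<exists>x\<in>unit_I. 1 - t < x \<and> x < 1 - t + \<delta> \<and> N \<le> \<bar>?q (1 - x)\<bar>" using x by blast
  qed
  show "max \<bar>dini_upper_left F t\<bar> \<bar>dini_lower_left F t\<bar> = \<infinity>" "\<not> left_derivative_exists F t"
    using limits_of_rough_quotient[OF flat steep]
    by (auto simp: dini_upper_left_def dini_lower_left_def left_derivative_exists_def diff_quot_def[abs_def])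
qed

theorem (in gap_data) besicovitch_morse_f:
  "besicovitch_function f" "morse_function f"
proof -
  have right: "max \<bar>dini_upper_right f t\<bar> \<bar>dini_lower_right f t\<bar> = \<infinity>" "\<not> right_derivative_exists f t"
    if "t \<in> unit_I" "t \<noteq> 1" for t
    using rough_right[OF f_rough, of t] that by auto
  have left: "max \<bar>dini_upper_left f t\<bar> \<bar>dini_lower_left f t\<bar> = \<infinity>" "\<not> left_derivative_exists f t"
    if "t \<in> unit_I" "t \<noteq> 0" for t
    using rough_left[OF f_rough f_reflect, of t] that by auto
  show "besicovitch_function f" "morse_function f"
    using left right f_continuous by (auto simp: besicovitch_function_def morse_function_def)
qed

section \<open>Dyadic levels\<close>

text \<open>
  The levels are the odd multiples of \<open>1 / 2 ^ Suc n\<close> in the unit interval, \<open>2 ^ n\<close> of them for each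
  depth \<open>n\<close>. They are enumerated depth by depth, the index \<open>2 ^ n + j - 1\<close> standing for the fraction
  \<open>(2 * j + 1) / 2 ^ Suc n\<close>. Apart from the restriction \<open>h i \<le> \<beta> i\<close>, the heights are \<open>1 / Suc n\<close>,
  which tends to \<open>0\<close> and yet exceeds the mesh \<open>1 / 2 ^ n\<close> by an unbounded factor, as the covering
  conditions require; the first level of each depth has height
  equal to its level and so touches \<open>0\<close>.
\<close>

definition depth :: "nat \<Rightarrow> nat" where "depth i = floor_log (Suc i)"

definition dyadic_level :: "nat \<Rightarrow> real" where
  "dyadic_level i = (2 * real i + 3) / 2 ^ Suc (depth i) - 1"

definition dyadic_height :: "nat \<Rightarrow> real" where
  "dyadic_height i = min (dyadic_level i) (1 / real (Suc (depth i)))"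

lemma depth_bounds: "2 ^ depth i \<le> Suc i" "Suc i < 2 * 2 ^ depth i"
  unfolding depth_def by (rule floor_log_exp2_le; simp) (rule floor_log_exp2_gt)

lemma level_of_depth:
  assumes "j < 2 ^ n"
  shows "depth (2 ^ n + j - 1) = n" "dyadic_level (2 ^ n + j - 1) = (2 * real j + 1) / 2 ^ Suc n"
proof -
  have s: "Suc (2 ^ n + j - 1) = 2 ^ n + j" using one_le_power[of "2::nat" n] by simp
  show o: "depth (2 ^ n + j - 1) = n"
    unfolding depth_def s using assms by (intro floor_log_eqI) auto
  have "real (2 ^ n + j - 1) + 1 = real (Suc (2 ^ n + j - 1))" by (simp only: of_nat_Suc add.commute)
  also have "\<dots> = 2 ^ n + real j" unfolding s by simp
  finally have "2 * real (2 ^ n + j - 1) + 3 = 2 * 2 ^ n + (2 * real j + 1)" by linarith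
  then show "dyadic_level (2 ^ n + j - 1) = (2 * real j + 1) / 2 ^ Suc n"
    unfolding dyadic_level_def o by (simp add: field_simps)
qed

lemma dyadic_level_bounds: "1 / 2 ^ Suc (depth i) \<le> dyadic_level i" "dyadic_level i < 1"
proof -
  have "real (2 ^ depth i) \<le> real (Suc i)" "real (Suc (Suc i)) \<le> real (2 * 2 ^ depth i)"
    using depth_bounds[of i] by (simp_all only: of_nat_le_iff Suc_le_eq)
  then show "1 / 2 ^ Suc (depth i) \<le> dyadic_level i" "dyadic_level i < 1"
    by (auto simp: dyadic_level_def field_simps)
qed

text \<open>
  Equality of fractions of different depths would make an odd number even.
\<close>

lemma dyadic_level_inj: "inj dyadic_level"
proof -
  have ne: "dyadic_level i \<noteq> dyadic_level j" if "depth i < depth j" for i j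
  proof
    assume "dyadic_level i = dyadic_level j"
    then have "(2 * real i + 3) * 2 ^ depth j = (2 * real j + 3) * 2 ^ depth i"
      by (simp add: dyadic_level_def field_simps)
    then have "real ((2 * i + 3) * 2 ^ depth j) = real ((2 * j + 3) * 2 ^ depth i)" by simp
    then have "(2 * i + 3) * 2 ^ depth j = (2 * j + 3) * 2 ^ depth i" by (simp only: of_nat_eq_iff)
    moreover obtain k where k: "depth j = depth i + Suc k" using less_imp_Suc_add[OF \<open>depth i < depth j\<close>] by auto
    ultimately have "2 * ((2 * i + 3) * 2 ^ k) = 2 * j + 3" by (simp add: power_add)
    then show False by presburger
  qed
  show ?thesis
  proof (rule injI)
    fix i j assume eq: "dyadic_level i = dyadic_level j"
    then have "depth i = depth j" using ne[of i j] ne[of j i] by (cases "depth i" "depth j" rule: linorder_cases) auto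
    then show "i = j" using eq by (simp add: dyadic_level_def)
  qed
qed

lemma dyadic_fine:
  fixes \<epsilon> :: real
  assumes "0 < \<epsilon>"
  shows "\<exists>n. real (Suc n) * (1 / 2) ^ n < \<epsilon>"
proof -
  have "(\<lambda>n. real n * (1 / 2) ^ n + (1 / 2) ^ n) \<longlonglongrightarrow> 0 + (0 :: real)"
    by (intro tendsto_add powser_times_n_limit_0 LIMSEQ_power_zero) auto
  then have "\<forall>\<^sub>F n in sequentially. dist (real n * (1 / 2) ^ n + (1 / 2) ^ n) (0 + 0) < \<epsilon>"
    using assms by (rule tendstoD)
  then obtain n where "dist (real n * (1 / 2) ^ n + (1 / 2) ^ n) (0 + 0) < \<epsilon>"
    by (auto simp: eventually_sequentially)
  then show ?thesis by (intro exI[of _ n]) (simp add: dist_real_def algebra_simps)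
qed

lemma dyadic_cover:
  assumes "0 < c" "c \<le> dyadic_level i" "depth i = n" "0 \<le> d" "d \<le> (1 / 2) ^ n"
    and n: "real (Suc n) * (1 / 2) ^ n * (\<bar>N\<bar> + 1) \<le> min c 1"
  shows "N * d \<le> dyadic_height i"
proof -
  have "N * d \<le> (\<bar>N\<bar> + 1) * (1 / 2) ^ n" using assms by (intro mult_mono) auto
  moreover have "(\<bar>N\<bar> + 1) * (1 / 2) ^ n * real (Suc n) \<le> 1" using n by (simp add: mult_ac)
  then have "(\<bar>N\<bar> + 1) * (1 / 2) ^ n \<le> 1 / real (Suc n)" by (subst pos_le_divide_eq) auto
  moreover have "(\<bar>N\<bar> + 1) * (1 / 2) ^ n \<le> c"
  proof -
    have "1 * ((1 / 2) ^ n * (\<bar>N\<bar> + 1)) \<le> real (Suc n) * ((1 / 2) ^ n * (\<bar>N\<bar> + 1))"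
      by (intro mult_right_mono) auto
    then show ?thesis using n by (simp add: mult_ac)
  qed
  ultimately show ?thesis using assms(2,3) by (auto simp: dyadic_height_def)
qed

lemma small_depth:
  fixes N c \<delta> :: real
  assumes "0 < c" "0 < \<delta>"
  shows "\<exists>n. real (Suc n) * (1 / 2) ^ n * (\<bar>N\<bar> + 1) \<le> min c 1 \<and> (1 / 2) ^ n < \<delta>"
proof -
  have "0 < min (min c 1 / (\<bar>N\<bar> + 1)) \<delta>" using assms by simp
  then obtain n where n: "real (Suc n) * (1 / 2) ^ n < min (min c 1 / (\<bar>N\<bar> + 1)) \<delta>"
    using dyadic_fine by blast
  have "1 * (1 / 2) ^ n \<le> real (Suc n) * (1 / 2 :: real) ^ n" by (intro mult_right_mono) auto
  also have "\<dots> < \<delta>" using n by simp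
  finally have "(1 / 2) ^ n < \<delta>" by simp
  moreover have "real (Suc n) * (1 / 2) ^ n < min c 1 / (\<bar>N\<bar> + 1)" using n by simp
  then have "real (Suc n) * (1 / 2) ^ n * (\<bar>N\<bar> + 1) < min c 1" by (subst (asm) pos_less_divide_eq) auto
  ultimately show ?thesis by (intro exI[of _ n]) auto
qed

interpretation dyadic: gap_data dyadic_level dyadic_height "\<lambda>i. (1 / 2) ^ (i + 3)"
proof
  show "inj dyadic_level" by (rule dyadic_level_inj)
  show "dyadic_level i < 1" for i by (rule dyadic_level_bounds)
  have pos: "0 < dyadic_level i" for i
    by (rule less_le_trans[OF _ dyadic_level_bounds(1)]) simp
  then show "0 < dyadic_height i" for i by (simp add: dyadic_height_def)
  show "dyadic_height i \<le> dyadic_level i" for i by (simp add: dyadic_height_def)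
  have zero: "dyadic_level 0 = 1 / 2" by (simp add: dyadic_level_def depth_def)
  then show "dyadic_level 0 = 1 / 2" "dyadic_height 0 = 1 / 2" by (auto simp: dyadic_height_def depth_def)
  show "dyadic_height i \<le> 1 / 2" for i
  proof (cases "depth i = 0")
    case True
    then have "i = 0" using depth_bounds(2)[of i] by simp
    then show ?thesis using zero by (simp add: dyadic_height_def)
  next
    case False
    then have "1 / real (Suc (depth i)) \<le> 1 / 2" by (intro divide_left_mono) auto
    then show ?thesis unfolding dyadic_height_def by (rule min.coboundedI2)
  qed
  show "dyadic_height \<longlonglongrightarrow> 0"
  proof (rule LIMSEQ_I)
    fix r :: real assume "0 < r"
    then obtain k where k: "inverse (real (Suc k)) < r" using reals_Archimedean by blast
    have "norm (dyadic_height i - 0) < r" if "i \<ge> 2 ^ k" for i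
    proof -
      have "k \<le> depth i" using floor_log_le_iff[of "2 ^ k" "Suc i"] that by (simp add: depth_def)
      then have "1 / real (Suc (depth i)) \<le> inverse (real (Suc k))" by (simp add: inverse_eq_divide divide_left_mono)
      then show ?thesis using k pos[of i] by (auto simp: dyadic_height_def)
    qed
    then show "\<exists>no. \<forall>i\<ge>no. norm (dyadic_height i - 0) < r" by blast
  qed
  show "0 < (1 / 2 :: real) ^ (i + 3)" for i by simp
  have "(\<lambda>i. (1 / 2 :: real) ^ i * (1 / 8)) sums (1 / (1 - 1 / 2) * (1 / 8))"
    by (intro sums_mult2 geometric_sums) simp
  then have "(\<lambda>i. (1 / 2 :: real) ^ (i + 3)) sums (1 / 4)" by (simp add: power_add power3_eq_cube)
  then show "summable (\<lambda>i. (1 / 2 :: real) ^ (i + 3))" "(\<Sum>i. (1 / 2 :: real) ^ (i + 3)) \<le> 1 / 4"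
    by (auto simp: sums_iff)
  show "\<exists>i. y < dyadic_level i \<and> dyadic_level i < y + \<delta> \<and> N * (dyadic_level i - y) \<le> dyadic_height i"
    if y: "0 < y" "y < 1" "0 < \<delta>" for y \<delta> N
  proof -
    obtain n where n: "real (Suc n) * (1 / 2) ^ n * (\<bar>N\<bar> + 1) \<le> min y 1" "(1 / 2) ^ n < min \<delta> (1 - y)"
      using small_depth[of y "min \<delta> (1 - y)" N] y by auto
    \<comment> \<open>the smallest \<open>j\<close> with \<open>y < (2 * j + 1) / 2 ^ Suc n\<close>\<close>
    define j where "j = nat \<lfloor>2 ^ n * y + 1 / 2\<rfloor>"
    have j: "real j \<le> 2 ^ n * y + 1 / 2" "2 ^ n * y - 1 / 2 < real j"
      using y by (auto simp: j_def) linarith+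
    have "1 < 2 ^ n * (1 - y)" using n(2) by (simp add: field_simps)
    then have "1 + 2 ^ n * y < 2 ^ n" by (simp add: algebra_simps)
    then have "real j < 2 ^ n" using j by linarith
    then have j2: "j < 2 ^ n" by simp
    let ?i = "2 ^ n + j - 1"
    have eq: "dyadic_level ?i - y = (real j + 1 / 2 - 2 ^ n * y) * (1 / 2) ^ n"
      unfolding level_of_depth(2)[OF j2] by (simp add: field_simps)
    have "0 < (real j + 1 / 2 - 2 ^ n * y) * (1 / 2) ^ n" using j by simp
    moreover have "(real j + 1 / 2 - 2 ^ n * y) * (1 / 2) ^ n \<le> 1 * (1 / 2) ^ n"
      using j by (intro mult_right_mono) auto
    ultimately have lv: "y < dyadic_level ?i" "dyadic_level ?i - y \<le> (1 / 2) ^ n"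
      unfolding eq[symmetric] by auto
    then have "N * (dyadic_level ?i - y) \<le> dyadic_height ?i"
      by (intro dyadic_cover[OF y(1) _ level_of_depth(1)[OF j2] _ _ n(1)]) auto
    then show ?thesis using lv n(2) by (intro exI[of _ ?i]) auto
  qed
  show "\<exists>i. y - \<delta> < dyadic_level i \<and> dyadic_level i < y \<and> N * (y - dyadic_level i) \<le> dyadic_height i"
    if y: "0 < y" "y \<le> 1" "0 < \<delta>" for y \<delta> N
  proof -
    obtain n where n: "real (Suc n) * (1 / 2) ^ n * (\<bar>N\<bar> + 1) \<le> min (y / 2) 1" "(1 / 2) ^ n < min \<delta> (y / 2)"
      using small_depth[of "y / 2" "min \<delta> (y / 2)" N] y by auto
    have n2: "2 < 2 ^ n * y" using n(2) by (simp add: field_simps)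
    \<comment> \<open>the largest \<open>j\<close> with \<open>(2 * j + 1) / 2 ^ Suc n < y\<close>\<close>
    define j where "j = nat (\<lceil>2 ^ n * y - 1 / 2\<rceil> - 1)"
    have j: "real j < 2 ^ n * y - 1 / 2" "2 ^ n * y - 3 / 2 \<le> real j"
      using n2 by (auto simp: j_def) linarith+
    have "2 ^ n * y \<le> 2 ^ n * 1" using y by (intro mult_left_mono) auto
    then have "real j < 2 ^ n" using j by linarith
    then have j2: "j < 2 ^ n" by simp
    let ?i = "2 ^ n + j - 1"
    have eq: "y - dyadic_level ?i = (2 ^ n * y - 1 / 2 - real j) * (1 / 2) ^ n"
      unfolding level_of_depth(2)[OF j2] by (simp add: field_simps)
    have "0 < (2 ^ n * y - 1 / 2 - real j) * (1 / 2) ^ n" using j by simp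
    moreover have "(2 ^ n * y - 1 / 2 - real j) * (1 / 2) ^ n \<le> 1 * (1 / 2) ^ n"
      using j by (intro mult_right_mono) auto
    ultimately have lv: "dyadic_level ?i < y" "y - dyadic_level ?i \<le> (1 / 2) ^ n"
      unfolding eq[symmetric] by auto
    have "N * (y - dyadic_level ?i) \<le> dyadic_height ?i"
      by (rule dyadic_cover[OF _ _ level_of_depth(1)[OF j2] _ lv(2) n(1)]) (use y lv n(2) in auto)
    then show ?thesis using lv n(2) by (intro exI[of _ ?i]) auto
  qed
  show "\<exists>i. dyadic_level i < \<delta> \<and> dyadic_height i = dyadic_level i" if "0 < \<delta>" for \<delta>
  proof -
    obtain n where n: "(1 / 2) ^ n < \<delta>" using real_arch_pow_inv[of \<delta> "1 / 2"] \<open>0 < \<delta>\<close> by auto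
    have lv: "depth (2 ^ n - 1) = n" "dyadic_level (2 ^ n - 1) = 1 / 2 ^ Suc n"
      using level_of_depth[of 0 n] by auto
    have "real (Suc n) \<le> real (2 ^ Suc n)"
      unfolding of_nat_le_iff using less_exp[of "Suc n"] by simp
    then have "1 / 2 ^ Suc n \<le> 1 / real (Suc n)" by (intro divide_left_mono) auto
    then have "dyadic_height (2 ^ n - 1) = dyadic_level (2 ^ n - 1)"
      unfolding dyadic_height_def lv by (rule min_absorb1)
    moreover have "1 / 2 ^ Suc n \<le> (1 / 2 :: real) ^ n" by (simp add: power_divide field_simps)
    ultimately show ?thesis using n lv(2) by (intro exI[of _ "2 ^ n - 1"]) auto
  qed
qed

theorem theorem4:
  shows "\<exists>f \<in> C_lambda. besicovitch_function f \<and> morse_function f"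
  using dyadic.f_in_C_lambda dyadic.besicovitch_morse_f by blast

end
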